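(* Assume the generalized Riemann hypothesis. Let $\Gamma$ be a finite abelian group with pairing of odd order. Then there exists a graph $G$ such that $\Gamma \cong \mathrm{Jac}(G)$ as groups with pairing.
   Context: The generalized Riemann hypothesis (GRH): for every Dirichlet character $\chi$, all zeros of the Dirichlet $L$-function $L(s,\chi)$ in the strip $0<\mathrm{Re}(s)<1$ lie on the line $\mathrm{Re}(s)=1/2$. A group with pairing is a finite abelian group $\Gamma$ together with a symmetric, bilinear, non-degenerate pairing $\langle\cdot,\cdot\rangle : \Gamma\times\Gamma \to \mathbb{Q}/\mathbb{Z}$; an isomorphism of groups with pairing is a group isomorphism preserving the pairings. A graph is a finite connected graph, possibly with multiple edges, but without loops. A divisor on $G$ is a formal integral combination $D=\sum_{v\in V(G)} D(v)v$, of degree $\sum_v D(v)$. For $f: V(G)\to\mathbb{Z}$ put $\mathrm{ord}_v(f)=\sum_{e=vw}(f(v)-f(w))$, the sum being over edges $e$ containing $v$ (counted with multiplicity), and $\mathrm{div}(f)=\sum_v \mathrm{ord}_v(f)v$. Divisors of the form $\mathrm{div}(f)$ are principal. The Jacobian $\mathrm{Jac}(G)$ is the (finite) group of degree-zero divisors modulo principal divisors. It carries the monodromy pairing: for degree-zero divisors $D_1,D_2$, choose an integer $m\geq 1$ and $f: V(G)\to\mathbb{Z}$ with $\mathrm{div}(f)=mD_1$, and set $\langle D_1,D_2\rangle=\frac1m\sum_{v\in V(G)} D_2(v)f(v) \in \mathbb{Q}/\mathbb{Z}$. As a group with pairing, $\mathrm{Jac}(G)$ is always equipped with this pairing. *)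

theory Defs
  imports
    "HOL-Complex_Analysis.Complex_Analysis"
    "HOL-Algebra.Free_Abelian_Groups"
    "HOL-Library.Multiset"
begin

section \<open>Dirichlet characters, L-functions and the generalized Riemann hypothesis\<close>

text \<open>
  The conditions force \<open>chi 1 = 1\<close>. Imprimitive and principal characters are included;
  for \<open>N = 1\<close> the only character is the constant \<open>1\<close>, whose L-function is the Riemann zeta
  function.
\<close>
definition dirichlet_character :: "nat \<Rightarrow> (int \<Rightarrow> complex) \<Rightarrow> bool" where
  "dirichlet_character N chi \<longleftrightarrow> N \<ge> 1 \<and>
     (\<forall>a b. chi (a * b) = chi a * chi b) \<and>
     (\<forall>a. chi (a + int N) = chi a) \<and>
     (\<forall>a. chi a \<noteq> 0 \<longleftrightarrow> coprime a (int N))"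

definition principal_character :: "(int \<Rightarrow> complex) \<Rightarrow> bool" where
  "principal_character chi \<longleftrightarrow> (\<forall>a. chi a = 0 \<or> chi a = 1)"

text \<open>
  The L-function is the analytic continuation of the Dirichlet series: to the whole plane for
  a non-principal character, and to the plane without the simple pole \<open>s = 1\<close> for a principal
  one. The continuation exists, and it is unique on these (connected, open) domains; the value
  at the pole is unspecified. The series is indexed by \<open>n = Suc k\<close>.
\<close>
definition is_dirichlet_L :: "(int \<Rightarrow> complex) \<Rightarrow> (complex \<Rightarrow> complex) \<Rightarrow> bool" where
  "is_dirichlet_L chi f \<longleftrightarrow>
     f holomorphic_on (if principal_character chi then - {1} else UNIV) \<and>
     (\<forall>s. Re s > 1 \<longrightarrow> (\<lambda>k. chi (int (Suc k)) / of_nat (Suc k) powr s) sums f s)"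

definition dirichlet_L :: "(int \<Rightarrow> complex) \<Rightarrow> complex \<Rightarrow> complex" where
  "dirichlet_L chi = (SOME f. is_dirichlet_L chi f)"

definition generalized_riemann_hypothesis :: bool where
  "generalized_riemann_hypothesis \<longleftrightarrow>
     (\<forall>N chi s. dirichlet_character N chi \<and> 0 < Re s \<and> Re s < 1 \<and> dirichlet_L chi s = 0
        \<longrightarrow> Re s = 1 / 2)"

lemma is_dirichlet_L_unique:
  assumes "is_dirichlet_L chi f" and "is_dirichlet_L chi g" and "s \<noteq> 1"
  shows "f s = g s"
proof -
  have hol: "f holomorphic_on - {1}" "g holomorphic_on - {1}"
    using assms by (auto simp: is_dirichlet_L_def split: if_splits intro: holomorphic_on_subset)
  have eq: "f z = g z" if "z \<in> {z. Re z > 1}" for z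
    using assms(1,2) that unfolding is_dirichlet_L_def by (blast intro: sums_unique2)
  have "f s - g s = 0"
  proof (rule analytic_continuation_open[where s = "{z. Re z > 1}" and s' = "- {1}"
        and f = "\<lambda>z. f z - g z" and g = "\<lambda>_. 0" and z = s])
    show "open {z. Re z > 1}" by (rule open_halfspace_Re_gt)
    show "open (- {1} :: complex set)" by auto
    show "{z. Re z > 1} \<noteq> {}" by (auto intro!: exI[of _ 2])
    show "connected (- {1} :: complex set)"
      by (rule connected_punctured_universe) simp
    show "{z. Re z > 1} \<subseteq> - {1}" by auto
    show "(\<lambda>z. f z - g z) holomorphic_on - {1}" by (intro holomorphic_intros hol)
    show "(\<lambda>_. 0 :: complex) holomorphic_on - {1}" by (intro holomorphic_intros)
  qed (use eq assms(3) in auto)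
  then show ?thesis by simp
qed


section \<open>The group \<open>\<rat>/\<int>\<close>\<close>

quotient_type rat_mod_int = rat / "\<lambda>x y. x - y \<in> \<int>"
  morphisms rep_rat_mod_int rat_mod_int
proof (rule equivpI)
  show "reflp (\<lambda>x y :: rat. x - y \<in> \<int>)" by (auto intro: reflpI)
  show "symp (\<lambda>x y :: rat. x - y \<in> \<int>)"
    by (rule sympI) (metis Ints_minus minus_diff_eq)
  show "transp (\<lambda>x y :: rat. x - y \<in> \<int>)"
    by (rule transpI) (metis Ints_add add_diff_eq diff_add_cancel)
qed

instantiation rat_mod_int :: ab_group_add
begin

lift_definition zero_rat_mod_int :: rat_mod_int is 0 .

lift_definition plus_rat_mod_int :: "rat_mod_int \<Rightarrow> rat_mod_int \<Rightarrow> rat_mod_int" is "(+)"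
  by (metis Ints_add add_diff_add)

lift_definition uminus_rat_mod_int :: "rat_mod_int \<Rightarrow> rat_mod_int" is uminus
  by (metis Ints_minus minus_diff_minus)

lift_definition minus_rat_mod_int :: "rat_mod_int \<Rightarrow> rat_mod_int \<Rightarrow> rat_mod_int" is "(-)"
  by (metis Ints_diff diff_diff_eq2 diff_diff_eq add.commute add_diff_eq)

instance
  by standard (transfer; simp add: algebra_simps)+

end

lemma rat_mod_int_eq_iff: "rat_mod_int x = rat_mod_int y \<longleftrightarrow> x - y \<in> \<int>"
  by (rule rat_mod_int.abs_eq_iff)


section \<open>Groups with pairing\<close>

text \<open>
  Linearity in the second argument and non-degeneracy on the other side follow by symmetry.
\<close>
locale group_with_pairing = comm_group \<Gamma> for \<Gamma> (structure) +
  fixes B :: "'a \<Rightarrow> 'a \<Rightarrow> rat_mod_int"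
  assumes finite_carrier: "finite (carrier \<Gamma>)"
    and symmetric: "\<lbrakk>x \<in> carrier \<Gamma>; y \<in> carrier \<Gamma>\<rbrakk> \<Longrightarrow> B x y = B y x"
    and bilinear: "\<lbrakk>x \<in> carrier \<Gamma>; y \<in> carrier \<Gamma>; z \<in> carrier \<Gamma>\<rbrakk> \<Longrightarrow> B (x \<otimes> y) z = B x z + B y z"
    and nondegenerate: "\<lbrakk>x \<in> carrier \<Gamma>; \<And>y. y \<in> carrier \<Gamma> \<Longrightarrow> B x y = 0\<rbrakk> \<Longrightarrow> x = \<one>"

definition isomorphic_with_pairing ::
  "('a, 'c) monoid_scheme \<Rightarrow> ('a \<Rightarrow> 'a \<Rightarrow> rat_mod_int) \<Rightarrow>
   ('b, 'd) monoid_scheme \<Rightarrow> ('b \<Rightarrow> 'b \<Rightarrow> rat_mod_int) \<Rightarrow> bool" where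
  "isomorphic_with_pairing \<Gamma> B \<Delta> C \<longleftrightarrow>
     (\<exists>\<phi> \<in> iso \<Gamma> \<Delta>. \<forall>x \<in> carrier \<Gamma>. \<forall>y \<in> carrier \<Gamma>. C (\<phi> x) (\<phi> y) = B x y)"


section \<open>Graphs\<close>

text \<open>
  An edge is its two-element set of endpoints, so loops are excluded; multiple edges are
  recorded by multiplicity in a multiset.
\<close>
record 'v multigraph =
  verts :: "'v set"
  edges :: "'v set multiset"

locale connected_multigraph =
  fixes G :: "'v multigraph"
  assumes finite_verts: "finite (verts G)"
    and edges_wf: "e \<in># edges G \<Longrightarrow> e \<subseteq> verts G \<and> card e = 2"
    and nonempty: "verts G \<noteq> {}"
    and connected: "\<lbrakk>u \<in> verts G; v \<in> verts G\<rbrakk> \<Longrightarrow> (u, v) \<in> {(x, y). {x, y} \<in># edges G}\<^sup>*"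


section \<open>Divisors, the Jacobian and the monodromy pairing\<close>

definition divisor_degree :: "('v \<Rightarrow>\<^sub>0 int) \<Rightarrow> int" where
  "divisor_degree D = (\<Sum>v \<in> Poly_Mapping.keys D. Poly_Mapping.lookup D v)"

text \<open>
  Functions on the vertices are total functions; values outside \<open>verts G\<close> play no role.
  The sum over the edges at \<open>v\<close> is grouped by the other endpoint \<open>w\<close>.
\<close>
definition vertex_ord :: "'v multigraph \<Rightarrow> ('v \<Rightarrow> int) \<Rightarrow> 'v \<Rightarrow> int" where
  "vertex_ord G f v = (\<Sum>w \<in> verts G. int (count (edges G) {v, w}) * (f v - f w))"

definition principal_divisor :: "'v multigraph \<Rightarrow> ('v \<Rightarrow> int) \<Rightarrow> ('v \<Rightarrow>\<^sub>0 int)" where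
  "principal_divisor G f = (\<Sum>v \<in> verts G. frag_cmul (vertex_ord G f v) (frag_of v))"

definition degree_zero_divisors :: "'v multigraph \<Rightarrow> ('v \<Rightarrow>\<^sub>0 int) monoid" where
  "degree_zero_divisors G = (free_Abelian_group (verts G))
     \<lparr>carrier := {D \<in> carrier (free_Abelian_group (verts G)). divisor_degree D = 0}\<rparr>"

definition Jac :: "'v multigraph \<Rightarrow> ('v \<Rightarrow>\<^sub>0 int) set monoid" where
  "Jac G = degree_zero_divisors G Mod range (principal_divisor G)"

text \<open>
  The value is independent of the representatives and of the choice of \<open>m\<close> and \<open>f\<close>
  (lemma \<open>is_monodromy_value_unique\<close> below).
\<close>
definition is_monodromy_value ::
  "'v multigraph \<Rightarrow> ('v \<Rightarrow>\<^sub>0 int) \<Rightarrow> ('v \<Rightarrow>\<^sub>0 int) \<Rightarrow> rat_mod_int \<Rightarrow> bool" where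
  "is_monodromy_value G D\<^sub>1 D\<^sub>2 q \<longleftrightarrow>
     (\<exists>m f. m \<ge> 1 \<and> principal_divisor G f = frag_cmul m D\<^sub>1 \<and>
        q = rat_mod_int (1 / of_int m * of_int (\<Sum>v \<in> verts G. Poly_Mapping.lookup D\<^sub>2 v * f v)))"

definition monodromy_pairing ::
  "'v multigraph \<Rightarrow> ('v \<Rightarrow>\<^sub>0 int) set \<Rightarrow> ('v \<Rightarrow>\<^sub>0 int) set \<Rightarrow> rat_mod_int" where
  "monodromy_pairing G X Y = (THE q. \<exists>D\<^sub>1 \<in> X. \<exists>D\<^sub>2 \<in> Y. is_monodromy_value G D\<^sub>1 D\<^sub>2 q)"


context connected_multigraph
begin

lemma lookup_principal_divisor:
  "Poly_Mapping.lookup (principal_divisor G f) v = (if v \<in> verts G then vertex_ord G f v else 0)"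
proof -
  have "Poly_Mapping.lookup (principal_divisor G f) v =
          (\<Sum>u \<in> verts G. if v = u then vertex_ord G f u else 0)"
    unfolding principal_divisor_def lookup_sum by (rule sum.cong) auto
  then show ?thesis using finite_verts by simp
qed

lemma keys_principal_divisor: "Poly_Mapping.keys (principal_divisor G f) \<subseteq> verts G"
  by (auto simp: in_keys_iff lookup_principal_divisor split: if_splits)

lemma divisor_degree_eq:
  assumes "Poly_Mapping.keys D \<subseteq> verts G"
  shows "divisor_degree D = (\<Sum>v \<in> verts G. Poly_Mapping.lookup D v)"
  unfolding divisor_degree_def
  by (rule sum.mono_neutral_left) (use assms finite_verts in \<open>auto simp: in_keys_iff\<close>)

lemma sum_vertex_ord_mult_commute:
  "(\<Sum>v \<in> verts G. vertex_ord G f v * g v) = (\<Sum>v \<in> verts G. vertex_ord G g v * f v)"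
proof -
  define c where "c v w = int (count (edges G) {v, w})" for v w
  have c: "c v w = c w v" for v w by (simp add: c_def insert_commute)
  have expand: "(\<Sum>v \<in> verts G. vertex_ord G f v * g v) =
      (\<Sum>v \<in> verts G. \<Sum>w \<in> verts G. c v w * (f v * g v)) -
      (\<Sum>v \<in> verts G. \<Sum>w \<in> verts G. c v w * (f w * g v))" for f g :: "'v \<Rightarrow> int"
    unfolding vertex_ord_def c_def sum_distrib_right sum_subtractf[symmetric]
    by (intro sum.cong refl) (simp add: algebra_simps)
  have "(\<Sum>v \<in> verts G. \<Sum>w \<in> verts G. c v w * (f w * g v)) =
        (\<Sum>v \<in> verts G. \<Sum>w \<in> verts G. c v w * (g w * f v))"
    by (subst sum.swap) (simp add: c mult_ac)
  then show ?thesis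
    unfolding expand by (simp add: mult_ac)
qed

lemma principal_divisor_in_carrier:
  "principal_divisor G f \<in> carrier (degree_zero_divisors G)"
proof -
  have "(\<Sum>v \<in> verts G. vertex_ord G f v) = 0"
    using sum_vertex_ord_mult_commute[of f "\<lambda>_. 1"] by (simp add: vertex_ord_def)
  then show ?thesis
    using keys_principal_divisor
    by (auto simp: degree_zero_divisors_def divisor_degree_eq lookup_principal_divisor)
qed

lemma principal_divisor_add:
  "principal_divisor G (\<lambda>v. f v + g v) = principal_divisor G f + principal_divisor G g"
  by (rule poly_mapping_eqI)
    (simp add: lookup_add lookup_principal_divisor vertex_ord_def algebra_simps sum.distrib
      sum_subtractf)

lemma principal_divisor_cmul:
  "principal_divisor G (\<lambda>v. k * f v) = frag_cmul k (principal_divisor G f)"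
  by (rule poly_mapping_eqI)
    (simp add: lookup_principal_divisor vertex_ord_def algebra_simps sum_distrib_left)

lemma comm_group_degree_zero_divisors: "comm_group (degree_zero_divisors G)"
proof -
  interpret F: comm_group "free_Abelian_group (verts G)"
    by (rule abelian_free_Abelian_group)
  let ?H = "{D \<in> carrier (free_Abelian_group (verts G)). divisor_degree D = 0}"
  have "subgroup ?H (free_Abelian_group (verts G))"
  proof (rule F.subgroupI)
    show "?H \<subseteq> carrier (free_Abelian_group (verts G))" by auto
    have "0 \<in> ?H" by (simp add: divisor_degree_def)
    then show "?H \<noteq> {}" by blast
  next
    fix D assume "D \<in> ?H"
    then show "inv\<^bsub>free_Abelian_group (verts G)\<^esub> D \<in> ?H"
      by (auto simp: divisor_degree_eq sum_negf)
  next
    fix D E assume DE: "D \<in> ?H" "E \<in> ?H"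
    then have "Poly_Mapping.keys (D + E) \<subseteq> verts G"
      using Poly_Mapping.keys_add[of D E] by auto
    then show "D \<otimes>\<^bsub>free_Abelian_group (verts G)\<^esub> E \<in> ?H"
      using DE by (auto simp: divisor_degree_eq lookup_add sum.distrib)
  qed
  then have "group (degree_zero_divisors G)"
    unfolding degree_zero_divisors_def by (rule F.subgroup_imp_group)
  then show ?thesis
    by (rule group.group_comm_groupI) (simp add: degree_zero_divisors_def add.commute)
qed

lemma subgroup_principal_divisors:
  "subgroup (range (principal_divisor G)) (degree_zero_divisors G)"
proof -
  interpret D: comm_group "degree_zero_divisors G" by (rule comm_group_degree_zero_divisors)
  have mult: "x \<otimes>\<^bsub>degree_zero_divisors G\<^esub> y = x + y" for x y
    by (simp add: degree_zero_divisors_def)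
  have one: "\<one>\<^bsub>degree_zero_divisors G\<^esub> = 0"
    by (simp add: degree_zero_divisors_def)
  show ?thesis
  proof (rule D.subgroupI)
    fix x assume "x \<in> range (principal_divisor G)"
    then obtain f where f: "x = principal_divisor G f" by blast
    have "principal_divisor G (\<lambda>v. (- 1) * f v) + x = 0"
      unfolding f principal_divisor_cmul by simp
    then have "inv\<^bsub>degree_zero_divisors G\<^esub> x = principal_divisor G (\<lambda>v. (- 1) * f v)"
      using D.inv_equality principal_divisor_in_carrier f mult one by metis
    then show "inv\<^bsub>degree_zero_divisors G\<^esub> x \<in> range (principal_divisor G)" by blast
  next
    fix x y assume "x \<in> range (principal_divisor G)" "y \<in> range (principal_divisor G)"
    then show "x \<otimes>\<^bsub>degree_zero_divisors G\<^esub> y \<in> range (principal_divisor G)"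
      unfolding mult by (auto simp flip: principal_divisor_add)
  qed (use principal_divisor_in_carrier in auto)
qed

lemma comm_group_Jac: "comm_group (Jac G)"
  unfolding Jac_def
  by (rule comm_group.abelian_FactGroup[OF comm_group_degree_zero_divisors
        subgroup_principal_divisors])

lemma constant_of_principal_divisor_eq_0:
  assumes "principal_divisor G f = 0" and "u \<in> verts G" and "v \<in> verts G"
  shows "f u = f v"
proof -
  define M where "M = Max (f ` verts G)"
  have le: "f x \<le> M" if "x \<in> verts G" for x
    using that finite_verts by (simp add: M_def)
  have "M \<in> f ` verts G"
    unfolding M_def using finite_verts nonempty by (intro Max_in) auto
  then obtain z where z: "z \<in> verts G" "f z = M" by auto
  have "y \<in> verts G \<and> f y = M" if "(z, y) \<in> {(x, y). {x, y} \<in># edges G}\<^sup>*" for y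
    using that
  proof (induction rule: rtrancl_induct)
    case base
    then show ?case using z by simp
  next
    case (step x y)
    have e: "{x, y} \<in># edges G" using step.hyps by simp
    then have y: "y \<in> verts G" using edges_wf[of "{x, y}"] by simp
    have "vertex_ord G f x = 0"
      using lookup_principal_divisor[of f x] assms(1) step.IH by simp
    then have "\<forall>w \<in> verts G. int (count (edges G) {x, w}) * (f x - f w) = 0"
      unfolding vertex_ord_def
      by (subst (asm) sum_nonneg_eq_0_iff) (use finite_verts step.IH le in auto)
    then have "int (count (edges G) {x, y}) * (f x - f y) = 0"
      using y by blast
    moreover have "count (edges G) {x, y} \<noteq> 0"
      using e by (simp only: count_eq_zero_iff not_not)
    ultimately have "f x = f y" by simp
    then show ?case using step.IH y by simp
  qed
  then show ?thesis using connected[OF z(1)] assms(2,3) by metis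
qed

lemma is_monodromy_value_unique:
  assumes D: "Poly_Mapping.keys D\<^sub>2 \<subseteq> verts G" "divisor_degree D\<^sub>2 = 0"
    and D1: "D\<^sub>1' = D\<^sub>1 + principal_divisor G g"
    and D2: "D\<^sub>2' = D\<^sub>2 + principal_divisor G h"
    and q: "is_monodromy_value G D\<^sub>1 D\<^sub>2 q" and q': "is_monodromy_value G D\<^sub>1' D\<^sub>2' q'"
  shows "q = q'"
proof -
  obtain m f where m: "m \<ge> 1" and f: "principal_divisor G f = frag_cmul m D\<^sub>1"
    and qf: "q = rat_mod_int (1 / of_int m * of_int (\<Sum>v \<in> verts G. Poly_Mapping.lookup D\<^sub>2 v * f v))"
    using q unfolding is_monodromy_value_def by blast
  obtain m' f' where m': "m' \<ge> 1" and f': "principal_divisor G f' = frag_cmul m' D\<^sub>1'"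
    and qf': "q' = rat_mod_int (1 / of_int m' * of_int (\<Sum>v \<in> verts G. Poly_Mapping.lookup D\<^sub>2' v * f' v))"
    using q' unfolding is_monodromy_value_def by blast
  define k where "k v = (m * f' v + (- m') * f v) + (- (m * m')) * g v" for v
  have "principal_divisor G k = 0"
    unfolding k_def principal_divisor_add principal_divisor_cmul f f' D1
    by (rule poly_mapping_eqI) (simp add: lookup_add algebra_simps)
  then have "\<exists>c. \<forall>v \<in> verts G. k v = c"
    using constant_of_principal_divisor_eq_0[of k] nonempty by blast
  then obtain c where c: "\<And>v. v \<in> verts G \<Longrightarrow> k v = c" by blast
  let ?S = "\<lambda>D f. \<Sum>v \<in> verts G. Poly_Mapping.lookup D v * f v"
  have "?S D\<^sub>2 k = c * (\<Sum>v \<in> verts G. Poly_Mapping.lookup D\<^sub>2 v)"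
    using c by (simp add: sum_distrib_left mult.commute)
  then have "?S D\<^sub>2 k = 0"
    using D by (simp add: divisor_degree_eq)
  then have 1: "m * ?S D\<^sub>2 f' = m' * ?S D\<^sub>2 f + m * m' * ?S D\<^sub>2 g"
    by (simp add: k_def algebra_simps sum.distrib sum_subtractf sum_distrib_left)
  have "?S (principal_divisor G h) f' = ?S (principal_divisor G f') h"
    using sum_vertex_ord_mult_commute[of h f'] by (simp add: lookup_principal_divisor)
  also have "\<dots> = m' * ?S D\<^sub>1' h"
    unfolding f' by (simp add: sum_distrib_left mult.assoc)
  finally have "?S D\<^sub>2' f' = ?S D\<^sub>2 f' + m' * ?S D\<^sub>1' h"
    unfolding D2 by (simp add: lookup_add distrib_right sum.distrib)
  then have 2: "m * ?S D\<^sub>2' f' = m' * ?S D\<^sub>2 f + m * m' * (?S D\<^sub>2 g + ?S D\<^sub>1' h)"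
    using 1 by (simp only: distrib_left mult.assoc)
  have "rat_mod_int (1 / of_int m * of_int a) = rat_mod_int (1 / of_int m' * of_int b)"
    if "m * b = m' * a + m * m' * d" for a b d
  proof -
    have "(of_int m * of_int b :: rat) = of_int m' * of_int a + of_int m * of_int m' * of_int d"
      using that by (simp only: flip: of_int_mult of_int_add)
    then have "1 / of_int m * of_int a - 1 / of_int m' * of_int b = (of_int (- d) :: rat)"
      using m m' by (simp add: field_simps)
    then show ?thesis
      unfolding rat_mod_int_eq_iff by (simp only: Ints_of_int)
  qed
  from this[OF 2] show ?thesis
    unfolding qf qf' .
qed

end

end

theory Submission
  imports Defs "HOL-Algebra.Multiplicative_Group"
begin

text \<open>
  Since the order is odd, polarisation yields an element \<open>z\<close> whose order \<open>n\<close> is also the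
  order of \<open>B z z = a / n\<close>. It splits off orthogonally, so by induction the group is an
  orthogonal sum of such cyclic groups. Wedging graphs at a common vertex \<open>0\<close> gives the
  orthogonal sum of their Jacobians, which leaves one cyclic summand. Expand \<open>n / a\<close> as a
  continued fraction \<open>b 1 - 1 / (b 2 - 1 / \<dots>)\<close> with all \<open>b j \<ge> 2\<close>. A path in which each
  vertex is also joined to \<open>0\<close> by as many edges as needed to give it degree \<open>b j\<close> has a
  tridiagonal reduced Laplacian whose cokernel is cyclic of order \<open>n\<close>, and an end of the path
  pairs with itself to \<open>a / n\<close>.
\<close>

section \<open>Pairings with values in \<open>\<rat>/\<int>\<close>\<close>

lemma rat_mod_int_add: "rat_mod_int x + rat_mod_int y = rat_mod_int (x + y)"
  by (rule plus_rat_mod_int.abs_eq)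

lemma rat_mod_int_eq_0_iff: "rat_mod_int x = 0 \<longleftrightarrow> x \<in> \<int>"
  by (simp add: zero_rat_mod_int_def rat_mod_int_eq_iff)

lemma rat_mod_int_cases: obtains q where "t = rat_mod_int q"
  by (induction t rule: rat_mod_int.abs_induct) blast

text \<open>By Bezout, \<open>t\<close> is an integer combination of the two given multiples. This
  is used to see that a denominator \<open>p\<close> survives multiplication by an integer prime to
  \<open>p\<close>.\<close>

lemma coprime_multiples_Ints:
  fixes t :: "'a :: comm_ring_1"
  assumes "coprime i j" "of_int i * t \<in> \<int>" "of_int j * t \<in> \<int>"
  shows "t \<in> \<int>"
proof -
  obtain u v where "u * i + v * j = 1"
    using assms(1) by (metis bezout_int coprime_iff_gcd_eq_1)
  then have "t = of_int (u * i + v * j) * t" by simp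
  also have "\<dots> = of_int u * (of_int i * t) + of_int v * (of_int j * t)"
    by (simp add: algebra_simps)
  also have "\<dots> \<in> \<int>" by (intro Ints_add Ints_mult[OF Ints_of_int] assms(2,3))
  finally show ?thesis .
qed

section \<open>The pairing on powers and products, and elements with non-degenerate
  self-pairing\<close>

context group_with_pairing
begin

lemma pairing_one: "y \<in> carrier \<Gamma> \<Longrightarrow> B \<one> y = 0"
  using bilinear[of \<one> \<one> y] by simp

lemma pairing_nat_pow:
  assumes "x \<in> carrier \<Gamma>" "y \<in> carrier \<Gamma>" "B x y = rat_mod_int q"
  shows "B (x [^] (k :: nat)) y = rat_mod_int (of_nat k * q)"
proof (induction k)
  case 0
  then show ?case using assms by (simp add: pairing_one rat_mod_int_eq_0_iff eq_commute[of 0])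
next
  case (Suc k)
  then show ?case using assms by (simp add: bilinear rat_mod_int_add algebra_simps)
qed

lemma pairing_inv:
  assumes "x \<in> carrier \<Gamma>" "y \<in> carrier \<Gamma>" "B x y = rat_mod_int q"
  shows "B (inv x) y = rat_mod_int (- q)"
proof -
  have "B (inv x) y + B x y = 0"
    using assms bilinear[of "inv x" x y] by (simp add: pairing_one)
  then have "B (inv x) y = - rat_mod_int q"
    using assms(3) by (simp add: eq_neg_iff_add_eq_0)
  then show ?thesis by (simp add: uminus_rat_mod_int.abs_eq)
qed

lemma pairing_int_pow:
  assumes "x \<in> carrier \<Gamma>" "y \<in> carrier \<Gamma>" "B x y = rat_mod_int q"
  shows "B (x [^] (k :: int)) y = rat_mod_int (of_int k * q)"
proof (cases k)
  case (nonneg n)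
  then show ?thesis using pairing_nat_pow[OF assms] by (simp add: int_pow_int)
next
  case (neg n)
  have "B (inv (x [^] Suc n)) y = rat_mod_int (- (of_nat (Suc n) * q))"
    using assms by (intro pairing_inv pairing_nat_pow) auto
  then show ?thesis
    using assms(1) by (simp only: neg int_pow_neg_int of_int_minus of_int_of_nat_eq mult_minus_left)
qed

lemma pairing_finprod:
  assumes "finite A" "f \<in> A \<rightarrow> carrier \<Gamma>" "y \<in> carrier \<Gamma>"
    and "\<And>i. i \<in> A \<Longrightarrow> B (f i) y = rat_mod_int (q i)"
  shows "B (finprod \<Gamma> f A) y = rat_mod_int (\<Sum>i \<in> A. q i)"
  using assms
proof (induction A rule: finite_induct)
  case empty
  then show ?case by (simp add: pairing_one rat_mod_int_eq_0_iff eq_commute[of 0])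
next
  case (insert a A)
  then have "f a \<in> carrier \<Gamma>" "f \<in> A \<rightarrow> carrier \<Gamma>" by auto
  with insert show ?case by (simp add: bilinear rat_mod_int_add finprod_closed)
qed

text \<open>
  The polarisation \<open>B (x y) (x y) = B x x + B y y + 2 B x y\<close> turns a pair witnessing
  non-degeneracy on the \<open>p\<close>-part, at its maximal exponent, into a single element.
\<close>
lemma anisotropic_element:
  assumes odd: "odd (order \<Gamma>)" and nontrivial: "carrier \<Gamma> \<noteq> {\<one>}"
  obtains z n a where "z \<in> carrier \<Gamma>" "n > 1" "z [^] n = \<one>" "0 < a" "a < int n" "coprime a (int n)"
    "B z z = rat_mod_int (of_int a / of_nat n)"
proof -
  have pos: "order \<Gamma> > 0"
    using finite_carrier order_gt_0_iff_finite by blast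
  obtain u where u: "u \<in> carrier \<Gamma>" "u \<noteq> \<one>" using nontrivial by blast
  then have "ord u \<noteq> 1" using ord_eq_1 by blast
  then obtain p where p: "prime p" "p dvd ord u" by (meson prime_factor_nat)
  have "p dvd order \<Gamma>" using p(2) u(1) ord_dvd_group_order[of u] dvd_trans by blast
  then have "odd p" using odd dvd_trans by blast
  obtain k m where km: "order \<Gamma> = p ^ k * m" "\<not> p dvd m"
    using multiplicity_decompose'[of "order \<Gamma>" p] pos p(1)
    by (metis not_prime_unit gr_implies_not0)
  \<comment> \<open>\<open>P r\<close> says that \<open>p ^ r\<close> kills all \<open>m\<close>-th
    powers, that is, the \<open>p\<close>-part. It holds at \<open>k\<close> and fails at 0, so
    there is an \<open>r\<close> for which the \<open>p\<close>-part has exponent exactly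
    \<open>p ^ Suc r\<close>.\<close>
  define P where "P r \<longleftrightarrow> (\<forall>x \<in> carrier \<Gamma>. x [^] (m * p ^ r) = \<one>)" for r
  have "P k"
    using pow_order_eq_1 km(1) by (auto simp: P_def mult.commute)
  moreover have "\<not> P 0"
  proof
    assume "P 0"
    then have "ord u dvd m" using u(1) pow_eq_id by (auto simp: P_def)
    then show False using p(2) km(2) dvd_trans by blast
  qed
  ultimately have "\<exists>r. \<not> P r \<and> P (Suc r)"
    by (induction k) auto
  then obtain r where r: "\<not> P r" "P (Suc r)" by blast
  then obtain x where x: "x \<in> carrier \<Gamma>" "x [^] (m * p ^ r) \<noteq> \<one>"
    by (auto simp: P_def)
  then obtain y where y: "y \<in> carrier \<Gamma>" "B (x [^] (m * p ^ r)) y \<noteq> 0"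
    using nondegenerate[of "x [^] (m * p ^ r)"] by blast
  obtain q where q: "B x y = rat_mod_int q" by (rule rat_mod_int_cases)
  \<comment> \<open>The power \<open>m\<close> moves both elements into the \<open>p\<close>-part;
    each argument contributes one factor \<open>m\<close> to the value \<open>q\<close>.\<close>
  define X Y where "X = x [^] m" and "Y = y [^] m"
  have XY: "X \<in> carrier \<Gamma>" "Y \<in> carrier \<Gamma>" using x y by (auto simp: X_def Y_def)
  have killed: "X [^] (p ^ Suc r) = \<one>" "Y [^] (p ^ Suc r) = \<one>"
    using r(2) x(1) y(1) unfolding P_def X_def Y_def by (simp_all add: nat_pow_pow)
  have BXy: "B X y = rat_mod_int (of_nat m * q)"
    unfolding X_def using x(1) y(1) q by (rule pairing_nat_pow)
  have "B Y X = rat_mod_int (of_nat m * (of_nat m * q))"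
    unfolding Y_def using XY(1) y(1) BXy by (intro pairing_nat_pow) (auto simp: symmetric)
  then have BXY: "B X Y = rat_mod_int (of_nat m * (of_nat m * q))"
    using XY symmetric by simp
  have ppow: "of_nat (p ^ Suc r) * s \<in> \<int>"
    if "w \<in> carrier \<Gamma>" "w [^] (p ^ Suc r) = \<one>" "v \<in> carrier \<Gamma>" "B w v = rat_mod_int s" for w v s
    using pairing_nat_pow[OF that(1,3,4), of "p ^ Suc r"] that(2,3)
    by (simp only: pairing_one) (metis rat_mod_int_eq_0_iff)
  have notin: "of_nat (p ^ r) * (of_nat m * q) \<notin> \<int>"
    using y(2) pairing_nat_pow[OF x(1) y(1) q, of "m * p ^ r"]
    by (simp add: rat_mod_int_eq_0_iff mult_ac)
  \<comment> \<open>Oddness of the order enters here: the factor 2 of the polarisation is invertible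
    modulo \<open>p\<close>.\<close>
  have "coprime p (2 * m)"
    using p(1) km(2) \<open>odd p\<close> by (simp add: prime_imp_coprime)
  then have cop: "coprime (int p) (int (2 * m))" by (simp only: coprime_int_iff)
  \<comment> \<open>Put \<open>t = p ^ r * m * q\<close>. Then \<open>p * t\<close> is an integer
    but \<open>t\<close> is not, so \<open>2 * m * t\<close> cannot be one either.\<close>
  have notin2: "of_nat (p ^ r) * (2 * (of_nat m * (of_nat m * q))) \<notin> \<int>"
  proof
    assume *: "of_nat (p ^ r) * (2 * (of_nat m * (of_nat m * q))) \<in> \<int>"
    have "of_int (int p) * (of_nat (p ^ r) * (of_nat m * q)) \<in> \<int>"
      using ppow[OF XY(1) killed(1) y(1) BXy] by (simp add: mult_ac)
    moreover have "of_int (int (2 * m)) * (of_nat (p ^ r) * (of_nat m * q)) \<in> \<int>"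
      using * by (simp add: mult_ac)
    ultimately show False using coprime_multiples_Ints[OF cop] notin by blast
  qed
  obtain q1 where q1: "B X X = rat_mod_int q1" by (rule rat_mod_int_cases)
  obtain q2 where q2: "B Y Y = rat_mod_int q2" by (rule rat_mod_int_cases)
  obtain q3 where q3: "B (X \<otimes> Y) (X \<otimes> Y) = rat_mod_int q3" by (rule rat_mod_int_cases)
  have bil2: "B w (X \<otimes> Y) = B w X + B w Y" if "w \<in> carrier \<Gamma>" for w
    using that XY bilinear[of X Y w] symmetric[of w] by simp
  have "rat_mod_int q3 = B X X + B Y Y + (B X Y + B X Y)"
    using XY bil2 symmetric[of Y X] by (simp add: bilinear add_ac flip: q3)
  also have "\<dots> = rat_mod_int (q1 + q2 + 2 * (of_nat m * (of_nat m * q)))"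
    by (simp add: q1 q2 BXY rat_mod_int_add mult_ac)
  finally have int: "q3 - (q1 + q2 + 2 * (of_nat m * (of_nat m * q))) \<in> \<int>"
    by (simp only: rat_mod_int_eq_iff)
  \<comment> \<open>Modulo integers the left side is \<open>p ^ r * (q3 - q1 - q2)\<close>, so
    \<open>p ^ r\<close> cannot clear the denominators of all three self-pairings.\<close>
  have "of_nat (p ^ r) * (2 * (of_nat m * (of_nat m * q))) =
      of_nat (p ^ r) * q3 - of_nat (p ^ r) * q1 - of_nat (p ^ r) * q2
      - of_nat (p ^ r) * (q3 - (q1 + q2 + 2 * (of_nat m * (of_nat m * q))))"
    by (simp add: algebra_simps)
  moreover have "of_nat (p ^ r) * (q3 - (q1 + q2 + 2 * (of_nat m * (of_nat m * q)))) \<in> \<int>"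
    using int by (rule Ints_mult[OF Ints_of_nat])
  ultimately have "\<not> (of_nat (p ^ r) * q1 \<in> \<int> \<and> of_nat (p ^ r) * q2 \<in> \<int> \<and> of_nat (p ^ r) * q3 \<in> \<int>)"
    using notin2 by (metis Ints_diff)
  moreover have "(X \<otimes> Y) [^] (p ^ Suc r) = \<one>"
    using XY killed by (simp only: nat_pow_distrib r_one one_closed)
  \<comment> \<open>The element \<open>z\<close> is one of \<open>X\<close>, \<open>Y\<close> and
    \<open>X \<otimes> Y\<close>. Its self-pairing has denominator exactly
    \<open>p ^ Suc r\<close>.\<close>
  ultimately obtain z s where z: "z \<in> carrier \<Gamma>" "z [^] (p ^ Suc r) = \<one>"
    "B z z = rat_mod_int s" "of_nat (p ^ r) * s \<notin> \<int>"
    using XY killed q1 q2 q3 m_closed by metis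
  obtain A where A: "of_nat (p ^ Suc r) * s = of_int A"
    using ppow[OF z(1,2,1,3)] by (metis Ints_cases)
  have p0: "p > 0" using p(1) prime_gt_0_nat by blast
  let ?n = "p ^ Suc r"
  \<comment> \<open>Reduction modulo \<open>p ^ Suc r\<close> leaves the class in \<rat>/\<int>
    unchanged and provides the bounds needed for the continued fraction.\<close>
  define a where "a = A mod int ?n"
  have sA: "s = of_int A / of_nat ?n"
    using A p0 by (simp add: field_simps)
  have "\<not> int p dvd A"
  proof
    assume "int p dvd A"
    then obtain A' where "A = int p * A'" by blast
    then have "of_nat (p ^ r) * s = of_int A'" using sA p0 by simp
    then show False using z(4) by simp
  qed
  then have "coprime (int p) A" using p(1) by (simp add: prime_imp_coprime)
  then have "coprime A (int ?n)" by (simp add: coprime_commute)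
  then have copa: "coprime a (int ?n)"
    unfolding a_def using p0 by (subst coprime_mod_left_iff) auto
  have n1: "?n > 1" using prime_gt_1_nat[OF p(1)] by (rule one_less_power) simp
  have "a \<ge> 0" "a < int ?n" unfolding a_def using p0 by (auto simp del: power_Suc)
  moreover have "a \<noteq> 0" using copa n1 by (auto simp del: power_Suc)
  moreover have "s - of_int a / of_nat ?n \<in> \<int>"
  proof -
    have "of_int A = of_int (int ?n * (A div int ?n) + a)" unfolding a_def by simp
    then have "(of_int A :: rat) = of_nat ?n * of_int (A div int ?n) + of_int a"
      by (simp only: of_int_add of_int_mult of_int_of_nat_eq)
    then have "s - of_int a / of_nat ?n = of_int (A div int ?n)"
      using sA p0 by (simp add: field_simps)
    then show ?thesis by (simp only: Ints_of_int)
  qed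
  ultimately show ?thesis
    using that[of z ?n a] z(1-3) n1 copa by (simp add: rat_mod_int_eq_iff del: power_Suc)
qed

end

section \<open>Continued fractions\<close>

text \<open>For \<open>j > 0\<close> this is the determinant of the tridiagonal matrix with diagonal
  \<open>b 1\<close>, ..., \<open>b (j - 1)\<close> and off-diagonal entries -1; the index exceeds
  the size by one.\<close>

fun continuant :: "(nat \<Rightarrow> int) \<Rightarrow> nat \<Rightarrow> int" where
  "continuant b 0 = 0"
| "continuant b (Suc 0) = 1"
| "continuant b (Suc (Suc j)) = b (Suc j) * continuant b (Suc j) - continuant b j"

lemma continuant_cong:
  assumes "\<And>i. 0 < i \<Longrightarrow> i < j \<Longrightarrow> b i = b' i"
  shows "continuant b j = continuant b' j"
  using assms by (induction b j rule: continuant.induct) auto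

text \<open>The \<open>b j\<close> are the partial quotients of the Hirzebruch--Jung continued fraction of \<open>n / a\<close>.\<close>
lemma continued_fraction_exists:
  assumes "0 < a" "a < n" "coprime a n"
  obtains k b where "continuant b (Suc k) = a" "continuant b (Suc (Suc k)) = n"
    "\<And>j. 0 < j \<Longrightarrow> j \<le> Suc k \<Longrightarrow> b j \<ge> 2"
proof -
  have "\<exists>k b. continuant b (Suc k) = a \<and> continuant b (Suc (Suc k)) = n \<and>
          (\<forall>j. 0 < j \<and> j \<le> Suc k \<longrightarrow> b j \<ge> 2)"
    using assms
  proof (induction "nat a" arbitrary: a n rule: less_induct)
    case less
    show ?case
    proof (cases "a = 1")
      case True
      with less.prems show ?thesis
        by (intro exI[of _ 0] exI[of _ "\<lambda>_. n"]) auto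
    next
      case False
      \<comment> \<open>A Euclidean step with rounding up: \<open>n + a' = a * q\<close> means
        \<open>n / a = q - a' / a\<close>, and the induction hypothesis expands
        \<open>a / a'\<close>.\<close>
      define a' where "a' = (- n) mod a"
      have cop: "coprime a' a" using less.prems by (simp add: a'_def coprime_commute)
      have a': "a' \<ge> 0" "a' < a" using less.prems by (auto simp: a'_def)
      moreover have "a' \<noteq> 0" using cop False less.prems by auto
      ultimately obtain k b where b: "continuant b (Suc k) = a'" "continuant b (Suc (Suc k)) = a"
        "\<And>j. 0 < j \<Longrightarrow> j \<le> Suc k \<Longrightarrow> b j \<ge> 2"
        using less.hyps[of a' a] cop by auto
      have "a dvd - n - a'" unfolding a'_def by (rule dvd_minus_mod)
      then have "a dvd n + a'" by (metis dvd_minus_iff minus_add_distrib minus_diff_eq diff_minus_eq_add add.commute)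
      then obtain q where q: "n + a' = a * q" by blast
      have "a < a * q" using q less.prems a' by linarith
      then have "q \<ge> 2" using less.prems by simp
      \<comment> \<open>The outermost quotient \<open>q\<close> goes last. Continuants of index at
        most \<open>Suc (Suc k)\<close> do not see this entry.\<close>
      define b' where "b' = b(Suc (Suc k) := q)"
      have "continuant b' j = continuant b j" if "j \<le> Suc (Suc k)" for j
        using that by (intro continuant_cong) (auto simp: b'_def)
      then have "continuant b' (Suc (Suc k)) = a" "continuant b' (Suc (Suc (Suc k))) = n"
        using b(1,2) q by (auto simp: b'_def mult.commute)
      moreover have "\<forall>j. 0 < j \<and> j \<le> Suc (Suc k) \<longrightarrow> b' j \<ge> 2"
        using b(3) \<open>q \<ge> 2\<close> by (auto simp: b'_def le_Suc_eq)
      ultimately show ?thesis by blast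
    qed
  qed
  then show ?thesis using that by blast
qed

section \<open>Potentials and Green's function on a path\<close>

text \<open>
  \<open>s\<close> and \<open>r\<close> solve the same three-term recursion from the two ends of a path, so that
  \<open>s (min i j) * r (max i j) / n\<close> is the Green's function of the path.
\<close>
locale path_potentials =
  fixes k :: nat and b s r :: "nat \<Rightarrow> int" and n :: int
  assumes k_pos: "k > 0"
    and s_0: "s 0 = 0"
    and s_Suc: "\<And>j. 0 < j \<Longrightarrow> j \<le> k \<Longrightarrow> s (Suc j) = b j * s j - s (j - 1)"
    and s_end: "s (Suc k) = n"
    and r_end: "r k = 1" "r (Suc k) = 0"
    and r_pred: "\<And>j. 0 < j \<Longrightarrow> j \<le> k \<Longrightarrow> r (j - 1) = b j * r j - r (Suc j)"
    and b_ge_2: "\<And>j. 0 < j \<Longrightarrow> j \<le> k \<Longrightarrow> b j \<ge> 2"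
begin

definition green :: "nat \<Rightarrow> nat \<Rightarrow> int" where
  "green i j = s (min i j) * r (max i j)"

text \<open>The common recursion of \<open>s\<close> and \<open>r\<close> keeps this discrete
  Wronskian constant along the path; its value is read off at \<open>j = k\<close>.\<close>

lemma wronskian: "j \<le> k \<Longrightarrow> s (Suc j) * r j - s j * r (Suc j) = n"
proof (induction rule: inc_induct)
  case base
  show ?case by (simp add: r_end s_end)
next
  case (step j)
  then have "r j = b (Suc j) * r (Suc j) - r (Suc (Suc j))"
    "s (Suc (Suc j)) = b (Suc j) * s (Suc j) - s j"
    using s_Suc[of "Suc j"] r_pred[of "Suc j"] by simp_all
  with step.IH show ?case by (simp only:) (simp add: algebra_simps)
qed

text \<open>On either side of \<open>i\<close>, \<open>green i\<close> is a multiple of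
  \<open>s\<close> or of \<open>r\<close>, which the recursion annihilates; at \<open>t = i\<close>
  the two branches differ by the Wronskian. With the boundary zeros, \<open>green / n\<close> thus
  inverts the tridiagonal matrix.\<close>

lemma green_laplacian:
  assumes "0 < i" "i \<le> k" "0 < t" "t \<le> k"
  shows "b t * green i t - green i (t - 1) - green i (Suc t) = (if t = i then n else 0)"
proof -
  consider "t < i" | "t = i" | "i < t" by linarith
  then show ?thesis
  proof cases
    case 1
    then have "green i t = s t * r i" "green i (t - 1) = s (t - 1) * r i" "green i (Suc t) = s (Suc t) * r i"
      by (simp_all add: green_def)
    then show ?thesis using s_Suc[OF assms(3,4)] 1 by (simp add: algebra_simps)
  next
    case 2
    then have "green i t = s i * r i" "green i (t - 1) = s (i - 1) * r i" "green i (Suc t) = s i * r (Suc i)"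
      by (simp_all add: green_def)
    moreover have "b i * s i = s (Suc i) + s (i - 1)" using s_Suc[OF assms(1,2)] by simp
    then have "b i * s i * r i = s (Suc i) * r i + s (i - 1) * r i" by (simp add: algebra_simps)
    ultimately show ?thesis using wronskian[OF assms(2)] 2 by (simp add: algebra_simps)
  next
    case 3
    then have "green i t = s i * r t" "green i (t - 1) = s i * r (t - 1)" "green i (Suc t) = s i * r (Suc t)"
      by (auto simp: green_def min_def max_def)
    moreover have "b t * (s i * r t) - s i * r (t - 1) - s i * r (Suc t) = 0"
      by (subst r_pred[OF assms(3,4)]) (simp add: algebra_simps)
    ultimately show ?thesis using 3 by simp
  qed
qed

lemma green_0: "green i 0 = 0"
  by (simp add: green_def s_0)

lemma green_end: "i \<le> k \<Longrightarrow> green i (Suc k) = 0"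
  by (simp add: green_def r_end)

lemma green_commute: "green i j = green j i"
  by (simp add: green_def min.commute max.commute)

text \<open>The difference obeys the same recursion and equals 0 at \<open>k\<close> and
  \<open>- n\<close> at \<open>Suc k\<close>; the induction carries two consecutive indices. Hence
  \<open>green i j\<close> is congruent to \<open>s k * r i * r j\<close> modulo \<open>n\<close>,
  the form taken by the pairing on powers of one element.\<close>

lemma s_cong_r: "j \<le> k \<Longrightarrow> n dvd s k * r j - s j"
proof -
  have "n dvd s k * r j - s j \<and> n dvd s k * r (Suc j) - s (Suc j)" if "j \<le> k"
    using that
  proof (induction rule: inc_induct)
    case base
    show ?case by (simp add: r_end s_end)
  next
    case (step j)
    let ?x = "\<lambda>j. s k * r j - s j"
    have "r j = b (Suc j) * r (Suc j) - r (Suc (Suc j))"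
      "s j = b (Suc j) * s (Suc j) - s (Suc (Suc j))"
      using s_Suc[of "Suc j"] r_pred[of "Suc j"] step.hyps by simp_all
    then have "?x j = b (Suc j) * ?x (Suc j) - ?x (Suc (Suc j))"
      by (simp only:) (simp add: algebra_simps)
    then show ?case using step.IH by (metis dvd_diff dvd_mult)
  qed
  then show "j \<le> k \<Longrightarrow> n dvd s k * r j - s j" by blast
qed

end

lemma path_potentials_exist:
  assumes "0 < a" "a < n" "coprime a n"
  obtains k b s r where "path_potentials k b s r n" "s k = a"
proof -
  obtain k b where kb: "continuant b (Suc k) = a" "continuant b (Suc (Suc k)) = n"
    "\<And>j. 0 < j \<Longrightarrow> j \<le> Suc k \<Longrightarrow> b j \<ge> 2"
    using continued_fraction_exists[OF assms] by metis
  \<comment> \<open>The continuant read from the far end: \<open>r j\<close> involves the entries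
    from \<open>b (Suc j)\<close> to \<open>b (Suc k)\<close>, on a path with \<open>Suc k\<close>
    vertices.\<close>
  define r where "r j = continuant (\<lambda>i. b (Suc (Suc k) - i)) (Suc (Suc k) - j)" for j
  have rec: "continuant d (Suc j) = d j * continuant d j - continuant d (j - 1)" if "0 < j" for d j
    using that by (cases j) auto
  have "path_potentials (Suc k) b (continuant b) r n"
  proof
    fix j assume j: "0 < j" "j \<le> Suc k"
    show "continuant b (Suc j) = b j * continuant b j - continuant b (j - 1)"
      by (rule rec[OF j(1)])
    have "Suc (Suc k) - (j - 1) = Suc (Suc (Suc k) - j)" "Suc (Suc k) - Suc j = Suc (Suc k) - j - 1"
      "Suc (Suc k) - (Suc (Suc k) - j) = j"
      using j by auto
    then show "r (j - 1) = b j * r j - r (Suc j)"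
      unfolding r_def using rec[of "Suc (Suc k) - j" "\<lambda>i. b (Suc (Suc k) - i)"] j by simp
  qed (use kb in \<open>auto simp: r_def\<close>)
  then show ?thesis using that kb(1) by blast
qed

section \<open>Recognising Jacobians by Green's functions\<close>

definition weighted_multigraph :: "nat \<Rightarrow> (nat \<Rightarrow> nat \<Rightarrow> nat) \<Rightarrow> nat multigraph" where
  "weighted_multigraph N c = \<lparr>verts = {..N},
     edges = (\<Sum>(i, j) \<in> {(i, j). i < j \<and> j \<le> N}. replicate_mset (c i j) {i, j})\<rparr>"

lemma finite_ordered_pairs: "finite {(i :: nat, j). i < j \<and> j \<le> N}"
  by (rule finite_subset[of _ "{..N} \<times> {..N}"]) auto

lemma verts_weighted_multigraph [simp]: "verts (weighted_multigraph N c) = {..N}"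
  by (simp add: weighted_multigraph_def)

lemma count_weighted_multigraph:
  assumes "\<And>i j. c i j = c j i" "u \<noteq> w" "u \<le> N" "w \<le> N"
  shows "count (edges (weighted_multigraph N c)) {u, w} = c u w"
proof -
  have "count (edges (weighted_multigraph N c)) {u, w} =
      (\<Sum>p \<in> {(i, j). i < j \<and> j \<le> N}. if p = (min u w, max u w) then c u w else 0)"
    unfolding weighted_multigraph_def using assms(1,2)
    by (auto simp: count_sum case_prod_beta doubleton_eq_iff min_def max_def intro!: sum.cong)
  also have "\<dots> = c u w"
    using assms(2-4) by (subst sum.delta[OF finite_ordered_pairs]) (auto simp: min_def max_def)
  finally show ?thesis .
qed

lemma edges_weighted_multigraph:
  assumes "e \<in># edges (weighted_multigraph N c)"
  shows "e \<subseteq> {..N} \<and> card e = 2"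
proof -
  obtain i j where "i < j" "j \<le> N" "e \<in># replicate_mset (c i j) {i, j}"
    using assms by (auto simp: weighted_multigraph_def set_mset_sum[OF finite_ordered_pairs])
  then show ?thesis by (auto simp: card_2_iff split: if_splits)
qed

text \<open>
  The class of \<open>v - 0\<close> is sent to \<open>psi v\<close>, and \<open>h / M\<close> is the inverse of the reduced Laplacian
  at the vertex \<open>0\<close>.
\<close>
locale pairing_realization = group_with_pairing \<Gamma> B
  for \<Gamma> :: "('a, 'b) monoid_scheme" (structure) and B :: "'a \<Rightarrow> 'a \<Rightarrow> rat_mod_int" +
  fixes N :: nat and c :: "nat \<Rightarrow> nat \<Rightarrow> nat" and M :: int
    and h :: "nat \<Rightarrow> nat \<Rightarrow> int" and psi :: "nat \<Rightarrow> 'a"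
  assumes weight_commute: "c i j = c j i"
    and reachable: "v \<le> N \<Longrightarrow> (0, v) \<in> {(x, y). x \<noteq> y \<and> x \<le> N \<and> y \<le> N \<and> c x y > 0}\<^sup>*"
    and M_pos: "M \<ge> 1"
    and green_root: "h 0 v = 0" "h v 0 = 0"
    and green_laplacian: "\<lbrakk>v \<le> N; 0 < u; u \<le> N\<rbrakk> \<Longrightarrow>
      (\<Sum>w\<le>N. int (c u w) * (h v u - h v w)) = (if u = v then M else 0)"
    and psi_closed: "v \<le> N \<Longrightarrow> psi v \<in> carrier \<Gamma>"
    and psi_root: "psi 0 = \<one>"
    and pairing_psi: "\<lbrakk>v \<le> N; w \<le> N\<rbrakk> \<Longrightarrow> B (psi v) (psi w) = rat_mod_int (of_int (h v w) / of_int M)"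
    and generating: "generate \<Gamma> (psi ` {..N}) = carrier \<Gamma>"
begin

section \<open>The graph of a realization\<close>

abbreviation "G \<equiv> weighted_multigraph N c"

lemma count_edges: "\<lbrakk>u \<noteq> w; u \<le> N; w \<le> N\<rbrakk> \<Longrightarrow> count (edges G) {u, w} = c u w"
  by (rule count_weighted_multigraph) (rule weight_commute)

lemma edge_iff: "\<lbrakk>x \<noteq> y; x \<le> N; y \<le> N\<rbrakk> \<Longrightarrow> {x, y} \<in># edges G \<longleftrightarrow> c x y > 0"
  by (simp add: count_edges flip: count_greater_zero_iff)

sublocale G: connected_multigraph G
proof
  fix u v assume uv: "u \<in> verts G" "v \<in> verts G"
  let ?E = "{(x, y). {x, y} \<in># edges G}"
  have "{(x, y). x \<noteq> y \<and> x \<le> N \<and> y \<le> N \<and> c x y > 0} \<subseteq> ?E"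
    using edge_iff by auto
  then have *: "(0, w) \<in> ?E\<^sup>*" if "w \<le> N" for w
    using reachable[OF that] rtrancl_mono by blast
  \<comment> \<open>Reachability is given only from the root, so a path from \<open>u\<close> is
    obtained by reversing one from 0.\<close>
  have "sym ?E" by (auto simp: sym_def insert_commute)
  then have "(u, 0) \<in> ?E\<^sup>*" using * uv(1) by (auto dest: sym_rtrancl symD)
  also have "(0, v) \<in> ?E\<^sup>*" using * uv(2) by simp
  finally show "(u, v) \<in> ?E\<^sup>*" .
qed (use edges_weighted_multigraph in auto)

text \<open>At \<open>w = u\<close>, where \<open>count_edges\<close> does not apply, the factor
  \<open>f u - f w\<close> vanishes.\<close>

lemma vertex_ord_eq:
  "u \<le> N \<Longrightarrow> vertex_ord G f u = (\<Sum>w\<le>N. int (c u w) * (f u - f w))"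
  unfolding vertex_ord_def verts_weighted_multigraph
  by (intro sum.cong refl)
    (metis (no_types, lifting) atMost_iff cancel_comm_monoid_add_class.diff_cancel count_edges
      mult_zero_right)

lemma degree_zero_carrier:
  "D \<in> carrier (degree_zero_divisors G) \<longleftrightarrow>
     Poly_Mapping.keys D \<subseteq> {..N} \<and> (\<Sum>v\<le>N. Poly_Mapping.lookup D v) = 0"
  using G.divisor_degree_eq[of D] by (auto simp: degree_zero_divisors_def)

section \<open>The homomorphism from divisors to the group\<close>

definition bracket :: "(nat \<Rightarrow>\<^sub>0 int) \<Rightarrow> (nat \<Rightarrow>\<^sub>0 int) \<Rightarrow> int" where
  "bracket D E = (\<Sum>w\<le>N. Poly_Mapping.lookup E w * (\<Sum>v\<le>N. Poly_Mapping.lookup D v * h v w))"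

definition hom_psi :: "(nat \<Rightarrow>\<^sub>0 int) \<Rightarrow> 'a" where
  "hom_psi D = finprod \<Gamma> (\<lambda>v. psi v [^] Poly_Mapping.lookup D v) {..N}"

lemma hom_psi_closed: "hom_psi D \<in> carrier \<Gamma>"
  unfolding hom_psi_def by (intro finprod_closed) (auto simp: psi_closed)

lemma hom_psi_add: "hom_psi (D + E) = hom_psi D \<otimes> hom_psi E"
proof -
  have "hom_psi (D + E) = finprod \<Gamma> (\<lambda>v. psi v [^] Poly_Mapping.lookup D v \<otimes> psi v [^] Poly_Mapping.lookup E v) {..N}"
    unfolding hom_psi_def by (intro finprod_cong) (auto simp: psi_closed lookup_add int_pow_mult simp_implies_def)
  also have "\<dots> = hom_psi D \<otimes> hom_psi E"
    unfolding hom_psi_def by (intro finprod_multf) (auto simp: psi_closed)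
  finally show ?thesis .
qed

text \<open>\<open>bracket\<close> is the bilinear form with Gram matrix \<open>h\<close>, so
  \<open>pairing_psi\<close> extends one argument at a time. Since \<open>pairing_finprod\<close>
  expands the first argument, symmetry is used to exchange the two.\<close>

lemma pairing_hom_psi: "B (hom_psi D) (hom_psi E) = rat_mod_int (of_int (bracket D E) / of_int M)"
proof -
  have half: "B (hom_psi D) (psi w) =
      rat_mod_int (\<Sum>v\<le>N. of_int (Poly_Mapping.lookup D v) * (of_int (h v w) / of_int M))"
    if "w \<le> N" for w
    unfolding hom_psi_def using that
    by (intro pairing_finprod pairing_int_pow) (auto simp: psi_closed pairing_psi)
  have "B (hom_psi E) (hom_psi D) = rat_mod_int (\<Sum>w\<le>N. of_int (Poly_Mapping.lookup E w) *
      (\<Sum>v\<le>N. of_int (Poly_Mapping.lookup D v) * (of_int (h v w) / of_int M)))"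
    unfolding hom_psi_def[of E]
    by (intro pairing_finprod pairing_int_pow) (auto simp: psi_closed hom_psi_closed half symmetric[of _ "hom_psi D"])
  also have "(\<Sum>w\<le>N. of_int (Poly_Mapping.lookup E w) *
      (\<Sum>v\<le>N. of_int (Poly_Mapping.lookup D v) * (of_int (h v w) / of_int M))) =
      (of_int (bracket D E) / of_int M :: rat)"
    unfolding bracket_def by (simp add: sum_divide_distrib sum_distrib_left mult.assoc)
  finally show ?thesis by (simp add: symmetric hom_psi_closed)
qed

text \<open>Away from the root this is \<open>green_laplacian\<close> extended linearly over
  \<open>D\<close>. At the root the coefficients agree because both divisors have degree
  zero.\<close>

lemma principal_potential:
  assumes "D \<in> carrier (degree_zero_divisors G)"
  shows "principal_divisor G (\<lambda>w. \<Sum>v\<le>N. Poly_Mapping.lookup D v * h v w) = frag_cmul M D"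
    (is "principal_divisor G ?f = _")
proof -
  have pos: "vertex_ord G ?f u = M * Poly_Mapping.lookup D u" if "0 < u" "u \<le> N" for u
  proof -
    have "vertex_ord G ?f u =
        (\<Sum>w\<le>N. \<Sum>v\<le>N. Poly_Mapping.lookup D v * (int (c u w) * (h v u - h v w)))"
      by (simp add: vertex_ord_eq that sum_subtractf[symmetric] sum_distrib_left algebra_simps)
    also have "\<dots> = (\<Sum>v\<le>N. Poly_Mapping.lookup D v * (\<Sum>w\<le>N. int (c u w) * (h v u - h v w)))"
      by (subst sum.swap) (simp add: sum_distrib_left)
    also have "\<dots> = (\<Sum>v\<le>N. if v = u then M * Poly_Mapping.lookup D u else 0)"
      using that by (intro sum.cong) (auto simp: green_laplacian)
    also have "\<dots> = M * Poly_Mapping.lookup D u" using that by simp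
    finally show ?thesis .
  qed
  have split: "(\<Sum>v\<le>N. F v) = F 0 + (\<Sum>v \<in> {0<..N}. F v)" for F :: "nat \<Rightarrow> int"
    using sum.remove[of "{..N}" 0 F] by (simp add: greaterThanAtMost_def atMost_def greaterThan_def Int_def set_diff_eq conj_commute)
  have "principal_divisor G ?f \<in> carrier (degree_zero_divisors G)"
    by (rule G.principal_divisor_in_carrier)
  then have "(\<Sum>v\<le>N. vertex_ord G ?f v) = 0"
    by (simp add: degree_zero_carrier G.lookup_principal_divisor)
  then have "vertex_ord G ?f 0 = - (\<Sum>v \<in> {0<..N}. vertex_ord G ?f v)"
    by (simp add: split)
  also have "\<dots> = - (\<Sum>v \<in> {0<..N}. M * Poly_Mapping.lookup D v)"
    by (simp add: pos)
  also have "\<dots> = M * Poly_Mapping.lookup D 0"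
  proof -
    have "Poly_Mapping.lookup D 0 = - (\<Sum>v \<in> {0<..N}. Poly_Mapping.lookup D v)"
      using assms split[of "Poly_Mapping.lookup D"] by (simp add: degree_zero_carrier)
    then show ?thesis by (simp add: sum_distrib_left)
  qed
  finally have "vertex_ord G ?f u = M * Poly_Mapping.lookup D u" if "u \<le> N" for u
    using that pos by (cases "u = 0") auto
  then show ?thesis
    using assms
    by (intro poly_mapping_eqI) (auto simp: G.lookup_principal_divisor degree_zero_carrier in_keys_iff)
qed

lemma monodromy_bracket:
  assumes "D \<in> carrier (degree_zero_divisors G)"
  shows "is_monodromy_value G D E (rat_mod_int (of_int (bracket D E) / of_int M))"
  unfolding is_monodromy_value_def
proof (intro exI conjI)
  show "M \<ge> 1" by (rule M_pos)
  show "principal_divisor G (\<lambda>w. \<Sum>v\<le>N. Poly_Mapping.lookup D v * h v w) = frag_cmul M D"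
    using assms by (rule principal_potential)
  show "rat_mod_int (of_int (bracket D E) / of_int M) = rat_mod_int (1 / of_int M * of_int
      (\<Sum>w\<in>verts G. Poly_Mapping.lookup E w * (\<Sum>v\<le>N. Poly_Mapping.lookup D v * h v w)))"
    by (simp add: bracket_def)
qed

lemma group_hom_psi: "group_hom (degree_zero_divisors G) \<Gamma> hom_psi"
proof -
  interpret D: comm_group "degree_zero_divisors G" by (rule G.comm_group_degree_zero_divisors)
  show ?thesis
    by unfold_locales
      (auto intro!: homI simp: hom_psi_closed degree_zero_divisors_def hom_psi_add)
qed

definition vertex_divisor :: "nat \<Rightarrow> (nat \<Rightarrow>\<^sub>0 int)" where
  "vertex_divisor w = frag_of w - frag_of 0"

lemma lookup_vertex_divisor:
  "Poly_Mapping.lookup (vertex_divisor w) v = (if v = w then 1 else 0) - (if v = 0 then 1 else 0)"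
  by (simp only: vertex_divisor_def lookup_minus lookup_frag_of)

lemma vertex_divisor_carrier:
  assumes "w \<le> N" shows "vertex_divisor w \<in> carrier (degree_zero_divisors G)"
proof -
  have "Poly_Mapping.keys (vertex_divisor w) \<subseteq> {..N}"
    using assms by (auto simp: in_keys_iff lookup_vertex_divisor split: if_splits)
  then show ?thesis
    using assms by (auto simp: degree_zero_carrier lookup_vertex_divisor sum_subtractf)
qed

lemma hom_psi_vertex:
  assumes "w \<le> N" shows "hom_psi (vertex_divisor w) = psi w"
proof -
  have "hom_psi (vertex_divisor w) = finprod \<Gamma> (\<lambda>v. if w = v then psi v else \<one>) {..N}"
    unfolding hom_psi_def using assms
    by (intro finprod_cong)
      (auto simp: psi_closed lookup_vertex_divisor psi_root int_pow_1 simp_implies_def)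
  also have "\<dots> = psi w"
    using assms by (subst finprod_singleton) (auto simp: psi_closed)
  finally show ?thesis .
qed

lemma bracket_vertex:
  assumes "w \<le> N"
  shows "bracket D (vertex_divisor w) = (\<Sum>v\<le>N. Poly_Mapping.lookup D v * h v w)"
proof -
  let ?f = "\<lambda>w. \<Sum>v\<le>N. Poly_Mapping.lookup D v * h v w"
  have "bracket D (vertex_divisor w) = (\<Sum>u\<le>N. if u = w then ?f u else 0)"
    unfolding bracket_def
    by (intro sum.cong) (auto simp: lookup_vertex_divisor green_root)
  then show ?thesis using assms by simp
qed

lemma hom_psi_surj: "hom_psi ` carrier (degree_zero_divisors G) = carrier \<Gamma>"
proof
  interpret P: group_hom "degree_zero_divisors G" \<Gamma> hom_psi by (rule group_hom_psi)
  show "carrier \<Gamma> \<subseteq> hom_psi ` carrier (degree_zero_divisors G)"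
    unfolding generating[symmetric]
  proof (rule generate_subgroup_incl)
    show "psi ` {..N} \<subseteq> hom_psi ` carrier (degree_zero_divisors G)"
      using hom_psi_vertex vertex_divisor_carrier by (force simp: image_iff)
    show "subgroup (hom_psi ` carrier (degree_zero_divisors G)) \<Gamma>"
      by (rule P.img_is_subgroup)
  qed
qed (use hom_psi_closed in auto)

text \<open>If \<open>hom_psi D\<close> is trivial, its pairings with all \<open>psi w\<close>
  vanish, which makes the potential of \<open>D\<close> divisible by \<open>M\<close>; the quotient
  is a function with divisor \<open>D\<close>. Conversely, a principal divisor pairs to zero with
  everything, and non-degeneracy applies.\<close>

lemma kernel_hom_psi: "kernel (degree_zero_divisors G) \<Gamma> hom_psi = range (principal_divisor G)"
proof (intro equalityI subsetI)
  fix D assume "D \<in> kernel (degree_zero_divisors G) \<Gamma> hom_psi"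
  then have D: "D \<in> carrier (degree_zero_divisors G)" "hom_psi D = \<one>" by (auto simp: kernel_def)
  let ?f = "\<lambda>w. \<Sum>v\<le>N. Poly_Mapping.lookup D v * h v w"
  have dvd: "M dvd ?f w" if "w \<le> N" for w
  proof -
    have "rat_mod_int (of_int (?f w) / of_int M) = 0"
      using pairing_hom_psi[of D "vertex_divisor w"] D(2) that
      by (simp add: bracket_vertex pairing_one hom_psi_closed)
    then have "(of_int (?f w) / of_int M :: rat) \<in> \<int>" by (simp only: rat_mod_int_eq_0_iff)
    then obtain i where "(of_int (?f w) / of_int M :: rat) = of_int i" by (rule Ints_cases)
    then have "(of_int (?f w) :: rat) = of_int (M * i)" using M_pos by (simp add: field_simps)
    then have "?f w = M * i" by (simp only: of_int_eq_iff)
    then show ?thesis by simp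
  qed
  define g where "g w = ?f w div M" for w
  have "frag_cmul M (principal_divisor G g) = principal_divisor G (\<lambda>w. M * g w)"
    by (simp add: G.principal_divisor_cmul)
  also have "\<dots> = principal_divisor G ?f"
    by (rule poly_mapping_eqI)
      (auto simp: G.lookup_principal_divisor vertex_ord_def g_def dvd intro!: sum.cong)
  also have "\<dots> = frag_cmul M D" using D(1) by (rule principal_potential)
  finally have "Poly_Mapping.lookup (frag_cmul M (principal_divisor G g)) v =
      Poly_Mapping.lookup (frag_cmul M D) v" for v by simp
  then have "principal_divisor G g = D"
    using M_pos by (intro poly_mapping_eqI) simp
  then show "D \<in> range (principal_divisor G)" by blast
next
  fix D assume "D \<in> range (principal_divisor G)"
  then obtain g where g: "D = principal_divisor G g" by blast
  then have D: "D \<in> carrier (degree_zero_divisors G)" using G.principal_divisor_in_carrier by simp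
  have "B (hom_psi D) y = 0" if "y \<in> carrier \<Gamma>" for y
  proof -
    obtain E where E: "E \<in> carrier (degree_zero_divisors G)" "y = hom_psi E"
      using \<open>y \<in> carrier \<Gamma>\<close> hom_psi_surj by blast
    \<comment> \<open>For principal \<open>D\<close> one may take \<open>m = 1\<close>, which gives
      an integral value, that is, zero. Uniqueness identifies it with the value obtained from
      \<open>M\<close>.\<close>
    have "is_monodromy_value G D E (rat_mod_int (of_int (\<Sum>v\<in>verts G. Poly_Mapping.lookup E v * g v)))"
      unfolding is_monodromy_value_def g by (intro exI[of _ 1] exI[of _ g]) auto
    moreover have "is_monodromy_value G D E (B (hom_psi D) y)"
      using monodromy_bracket[OF D] by (simp add: E(2) pairing_hom_psi)
    moreover have "Poly_Mapping.keys E \<subseteq> verts G" "divisor_degree E = 0"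
      using E(1) by (auto simp: degree_zero_divisors_def)
    moreover have "principal_divisor G (\<lambda>_. 0) = 0"
      by (rule poly_mapping_eqI) (simp add: G.lookup_principal_divisor vertex_ord_def)
    then have "D = D + principal_divisor G (\<lambda>_. 0)" "E = E + principal_divisor G (\<lambda>_. 0)" by simp_all
    ultimately have "B (hom_psi D) y = rat_mod_int (of_int (\<Sum>v\<in>verts G. Poly_Mapping.lookup E v * g v))"
      using G.is_monodromy_value_unique by metis
    then show ?thesis by (simp only: rat_mod_int_eq_0_iff Ints_of_int)
  qed
  then have "hom_psi D = \<one>" using nondegenerate hom_psi_closed by blast
  then show "D \<in> kernel (degree_zero_divisors G) \<Gamma> hom_psi" using D by (simp add: kernel_def)
qed

text \<open>The first isomorphism theorem for \<open>hom_psi\<close>, inverted. The pairings agree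
  because \<open>bracket\<close> divided by \<open>M\<close> computes both of them on
  representatives.\<close>

theorem isomorphic_Jac: "isomorphic_with_pairing \<Gamma> B (Jac G) (monodromy_pairing G)"
proof -
  interpret P: group_hom "degree_zero_divisors G" \<Gamma> hom_psi by (rule group_hom_psi)
  interpret J: comm_group "Jac G" by (rule G.comm_group_Jac)
  let ?F = "\<lambda>X. the_elem (hom_psi ` X)"
  have iso: "?F \<in> iso (Jac G) \<Gamma>"
    unfolding Jac_def kernel_hom_psi[symmetric] by (rule P.FactGroup_iso_set[OF hom_psi_surj])
  then have bij: "bij_betw ?F (carrier (Jac G)) (carrier \<Gamma>)" by (simp add: iso_def)
  define phi where "phi = inv_into (carrier (Jac G)) ?F"
  have phi: "phi \<in> iso \<Gamma> (Jac G)"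
    unfolding phi_def by (rule J.iso_set_sym[OF iso])
  \<comment> \<open>Each coset \<open>phi x\<close> gets a representative sent to \<open>x\<close>,
    together with the form of all others that uniqueness of monodromy values requires.\<close>
  have rep: "\<exists>D \<in> carrier (degree_zero_divisors G). hom_psi D = x \<and> D \<in> phi x \<and>
      (\<forall>E \<in> phi x. \<exists>g. E = D + principal_divisor G g)" if x: "x \<in> carrier \<Gamma>" for x
  proof -
    have X: "phi x \<in> carrier (Jac G)" "?F (phi x) = x"
      using iso_imp_homomorphism[OF phi] x bij_betw_inv_into_right[OF bij x]
      unfolding phi_def by (simp_all add: hom_in_carrier)
    then obtain D where D: "D \<in> carrier (degree_zero_divisors G)"
      "phi x = range (principal_divisor G) #>\<^bsub>degree_zero_divisors G\<^esub> D"
      by (auto simp: Jac_def FactGroup_def RCOSETS_def)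
    have coset: "phi x = {principal_divisor G g + D |g. True}"
      unfolding D(2) by (auto simp: r_coset_def degree_zero_divisors_def)
    have "hom_psi (principal_divisor G g) = \<one>" for g
      using kernel_hom_psi by (auto simp: kernel_def)
    then have same: "hom_psi E = hom_psi D" if "E \<in> phi x" for E
      using that unfolding coset by (auto simp: hom_psi_add hom_psi_closed)
    have "principal_divisor G (\<lambda>_. 0) = 0"
      by (rule poly_mapping_eqI) (simp add: G.lookup_principal_divisor vertex_ord_def)
    then have mem: "D \<in> phi x" unfolding coset by force
    then have "hom_psi ` phi x = {hom_psi D}" using same by blast
    then have "hom_psi D = x" using X(2) by simp
    moreover have "\<forall>E \<in> phi x. \<exists>g. E = D + principal_divisor G g"
      unfolding coset by (auto simp: add.commute)
    ultimately show ?thesis using D(1) mem by blast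
  qed
  have "monodromy_pairing G (phi x) (phi y) = B x y"
    if x: "x \<in> carrier \<Gamma>" and y: "y \<in> carrier \<Gamma>" for x y
  proof -
    obtain D where D: "D \<in> carrier (degree_zero_divisors G)" "hom_psi D = x" "D \<in> phi x"
      "\<And>E. E \<in> phi x \<Longrightarrow> \<exists>g. E = D + principal_divisor G g" using rep[OF x] by blast
    obtain E where E: "E \<in> carrier (degree_zero_divisors G)" "hom_psi E = y" "E \<in> phi y"
      "\<And>D. D \<in> phi y \<Longrightarrow> \<exists>g. D = E + principal_divisor G g" using rep[OF y] by blast
    have E': "Poly_Mapping.keys E \<subseteq> verts G" "divisor_degree E = 0"
      using E(1) by (auto simp: degree_zero_divisors_def)
    have val: "is_monodromy_value G D E (B x y)"
      using monodromy_bracket[OF D(1), of E] pairing_hom_psi[of D E] D(2) E(2) by simp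
    show ?thesis
      unfolding monodromy_pairing_def
    proof (rule the_equality)
      show "\<exists>D\<in>phi x. \<exists>E\<in>phi y. is_monodromy_value G D E (B x y)" using D(3) E(3) val by blast
    next
      fix q assume "\<exists>D\<in>phi x. \<exists>E\<in>phi y. is_monodromy_value G D E q"
      then obtain D' E' where "D' \<in> phi x" "E' \<in> phi y" "is_monodromy_value G D' E' q" by blast
      then show "q = B x y"
        using D(4) E(4) G.is_monodromy_value_unique[OF E' _ _ val] by metis
    qed
  qed
  then show ?thesis
    unfolding isomorphic_with_pairing_def using phi by blast
qed

end

section \<open>Splitting off a cyclic summand\<close>

context group_with_pairing
begin

definition orthogonal :: "'a \<Rightarrow> 'a set" where
  "orthogonal z = {w \<in> carrier \<Gamma>. B w z = 0}"

lemma orthogonal_subgroup: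
  assumes z: "z \<in> carrier \<Gamma>"
  shows "subgroup (orthogonal z) \<Gamma>"
proof (rule subgroupI)
  show "orthogonal z \<noteq> {}" using pairing_one[OF z] by (auto simp: orthogonal_def)
  show "inv w \<in> orthogonal z" if "w \<in> orthogonal z" for w
    using that pairing_inv[of w z 0] z by (auto simp: orthogonal_def zero_rat_mod_int_def)
  show "w \<otimes> w' \<in> orthogonal z" if "w \<in> orthogonal z" "w' \<in> orthogonal z" for w w'
    using that z by (auto simp: orthogonal_def bilinear)
qed (simp_all add: orthogonal_def)

end

text \<open>The data delivered by \<open>anisotropic_element\<close>. Coprimality makes the pairing
  non-degenerate on the cyclic group generated by \<open>z\<close>, whose order is then exactly
  \<open>n\<close>.\<close>

locale anisotropic_cyclic = group_with_pairing +
  fixes z and n :: nat and a :: int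
  assumes z: "z \<in> carrier \<Gamma>" and n_gt_1: "n > 1" and pow_n: "z [^] n = \<one>"
    and a_bounds: "0 < a" "a < int n" and coprime_a: "coprime a (int n)"
    and pairing_z: "B z z = rat_mod_int (of_int a / of_nat n)"
begin

abbreviation "H \<equiv> orthogonal z"

lemma z_notin_orthogonal: "z \<notin> H"
proof
  assume "z \<in> H"
  then have "(of_int a / of_nat n :: rat) \<in> \<int>"
    using pairing_z by (simp add: orthogonal_def rat_mod_int_eq_0_iff)
  then obtain i where "(of_int a / of_nat n :: rat) = of_int i" by (rule Ints_cases)
  then have "(of_int a :: rat) = of_int (int n * i)" using n_gt_1 by (simp add: field_simps)
  then have "a = int n * i" by (simp only: of_int_eq_iff)
  then have "int n dvd a" by simp
  then show False using a_bounds zdvd_imp_le by fastforce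
qed

text \<open>Orthogonal projection onto the powers of \<open>z\<close>: as \<open>z\<close> is killed
  by \<open>n\<close>, the value \<open>B w z\<close> has the form \<open>A / n\<close>, and some
  power of \<open>z\<close> has the same pairing with \<open>z\<close>.\<close>

lemma decompose:
  assumes w: "w \<in> carrier \<Gamma>"
  obtains i :: int and u where "u \<in> H" "w = z [^] i \<otimes> u"
proof -
  obtain q where q: "B w z = rat_mod_int q" by (rule rat_mod_int_cases)
  have "B z w = rat_mod_int q" using q symmetric[OF z w] by simp
  then have "B (z [^] n) w = rat_mod_int (of_nat n * q)" by (rule pairing_nat_pow[OF z w])
  then have "of_nat n * q \<in> \<int>" using pow_n w by (simp add: pairing_one) (metis rat_mod_int_eq_0_iff)
  then obtain A where A: "of_nat n * q = of_int A" by (rule Ints_cases)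
  obtain x y where xy: "x * a + y * int n = 1"
    using coprime_a by (metis bezout_int coprime_iff_gcd_eq_1)
  \<comment> \<open>Here \<open>x\<close> inverts \<open>a\<close> modulo \<open>n\<close>, so
    \<open>i * a\<close> is congruent to \<open>A\<close>.\<close>
  define i where "i = A * x"
  define u where "u = z [^] (- i) \<otimes> w"
  have "A - i * a = A * (x * a + y * int n) - A * x * a" unfolding i_def xy by simp
  then have A': "A - i * a = int n * (A * y)" by (simp add: algebra_simps)
  have "B u z = rat_mod_int (of_int (- i) * (of_int a / of_nat n) + q)"
    unfolding u_def using z w pairing_int_pow[OF z z pairing_z, of "- i"] q
    by (simp only: bilinear int_pow_closed rat_mod_int_add)
  also have "of_int (- i) * (of_int a / of_nat n) + q = of_int (A - i * a) / of_nat n"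
    using A n_gt_1 by (simp add: field_simps)
  also have "\<dots> = of_int (A * y)" unfolding A' using n_gt_1 by simp
  finally have "B u z = 0" by (simp only: rat_mod_int_eq_0_iff Ints_of_int)
  then have "u \<in> H" using w z by (simp add: orthogonal_def u_def)
  moreover have "w = z [^] i \<otimes> u"
    unfolding u_def using w z by (simp add: int_pow_neg m_assoc[symmetric])
  ultimately show ?thesis by (rule that)
qed

text \<open>Only non-degeneracy needs an argument: an element of \<open>H\<close> orthogonal to
  \<open>H\<close> is also orthogonal to \<open>z\<close>, hence to everything by
  \<open>decompose\<close>.\<close>

lemma group_with_pairing_orthogonal: "group_with_pairing (\<Gamma>\<lparr>carrier := H\<rparr>) B"
proof -
  interpret S: group "\<Gamma>\<lparr>carrier := H\<rparr>"
    using orthogonal_subgroup[OF z] by (rule subgroup_imp_group)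
  have sub: "H \<subseteq> carrier \<Gamma>" by (auto simp: orthogonal_def)
  have "comm_group (\<Gamma>\<lparr>carrier := H\<rparr>)"
    by (rule S.group_comm_groupI) (use sub m_comm in auto)
  moreover have "x = \<one>" if x: "x \<in> H" and 0: "\<And>y. y \<in> H \<Longrightarrow> B x y = 0" for x
  proof (rule nondegenerate)
    show xG: "x \<in> carrier \<Gamma>" using x sub by blast
    fix w assume "w \<in> carrier \<Gamma>"
    then obtain i u where iu: "u \<in> H" "w = z [^] (i :: int) \<otimes> u" by (rule decompose)
    have "B z x = rat_mod_int 0"
      using x symmetric[OF z xG] by (simp add: orthogonal_def zero_rat_mod_int_def)
    then have "B (z [^] i) x = 0"
      using pairing_int_pow[OF z xG] by (simp add: rat_mod_int_eq_0_iff)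
    moreover have uG: "u \<in> carrier \<Gamma>" using iu(1) sub by blast
    moreover have "B u x = 0" using 0[OF iu(1)] symmetric[OF uG xG] by simp
    ultimately have "B w x = 0" using iu(2) uG z xG by (simp add: bilinear)
    then show "B x w = 0" using symmetric[OF xG \<open>w \<in> carrier \<Gamma>\<close>] by simp
  qed
  moreover have "group_with_pairing_axioms (\<Gamma>\<lparr>carrier := H\<rparr>) B"
    if "\<And>x. x \<in> H \<Longrightarrow> (\<And>y. y \<in> H \<Longrightarrow> B x y = 0) \<Longrightarrow> x = \<one>"
  proof
    show "finite (carrier (\<Gamma>\<lparr>carrier := H\<rparr>))"
      using finite_subset[OF sub finite_carrier] by simp
    show "B x y = B y x" if "x \<in> carrier (\<Gamma>\<lparr>carrier := H\<rparr>)" "y \<in> carrier (\<Gamma>\<lparr>carrier := H\<rparr>)" for x y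
      using that sub by (intro symmetric) auto
    show "B (x \<otimes>\<^bsub>\<Gamma>\<lparr>carrier := H\<rparr>\<^esub> y) w = B x w + B y w"
      if "x \<in> carrier (\<Gamma>\<lparr>carrier := H\<rparr>)" "y \<in> carrier (\<Gamma>\<lparr>carrier := H\<rparr>)"
        "w \<in> carrier (\<Gamma>\<lparr>carrier := H\<rparr>)" for x y w
      using that sub bilinear[of x y w] by auto
    show "x = \<one>\<^bsub>\<Gamma>\<lparr>carrier := H\<rparr>\<^esub>"
      if "x \<in> carrier (\<Gamma>\<lparr>carrier := H\<rparr>)"
        "\<And>y. y \<in> carrier (\<Gamma>\<lparr>carrier := H\<rparr>) \<Longrightarrow> B x y = 0" for x
      using that \<open>\<And>x. x \<in> H \<Longrightarrow> (\<And>y. y \<in> H \<Longrightarrow> B x y = 0) \<Longrightarrow> x = \<one>\<close>[of x] by simp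
  qed
  ultimately show ?thesis by (intro group_with_pairing.intro) blast+
qed

lemma order_orthogonal_less: "order (\<Gamma>\<lparr>carrier := H\<rparr>) < order \<Gamma>"
proof -
  have "H \<subset> carrier \<Gamma>"
    using z z_notin_orthogonal by (auto simp: orthogonal_def)
  then show ?thesis by (simp add: order_def psubset_card_mono[OF finite_carrier])
qed

lemma order_orthogonal_dvd: "order (\<Gamma>\<lparr>carrier := H\<rparr>) dvd order \<Gamma>"
  using lagrange[OF orthogonal_subgroup[OF z]] by (simp add: order_def) (metis dvd_triv_right)

text \<open>The graph for \<open>z\<close> is glued at the vertex \<open>0\<close> to the graph for the orthogonal complement.\<close>
lemma extend_realization:
  assumes real: "pairing_realization (\<Gamma>\<lparr>carrier := H\<rparr>) B N c M h psi"
  shows "\<exists>N c M h psi. pairing_realization \<Gamma> B N c M h psi"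
proof -
  interpret R: pairing_realization "\<Gamma>\<lparr>carrier := H\<rparr>" B N c M h psi by (rule real)
  obtain k b s r where P: "path_potentials k b s r (int n)" and sk: "s k = a"
    by (rule path_potentials_exist[OF a_bounds coprime_a])
  interpret P: path_potentials k b s r "int n" by (rule P)
  \<comment> \<open>The number of edges from path vertex \<open>t\<close> to 0: it fills up the path
    degree to \<open>b t\<close>, and is non-negative since \<open>b t \<ge> 2\<close>.\<close>
  define d where "d t = nat (b t - (if t > 1 then 1 else 0) - (if t < k then 1 else 0))" for t
  \<comment> \<open>The path occupies the vertices \<open>N + 1\<close> to \<open>N + k\<close> and
    touches the old graph only at 0.\<close>
  define c' where "c' i j = (if i \<le> N \<and> j \<le> N then c i j else if i = 0 then d (j - N)
      else if j = 0 then d (i - N) else if i > N \<and> j > N \<and> (i = Suc j \<or> j = Suc i) then 1 else 0)" for i j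
  \<comment> \<open>Block diagonal, with both blocks brought to the common denominator
    \<open>M * n\<close>.\<close>
  define h' where "h' i j = (if i \<le> N \<and> j \<le> N then int n * h i j
      else if i > N \<and> j > N then M * P.green (i - N) (j - N) else 0)" for i j
  \<comment> \<open>The recursion of \<open>r\<close> encodes the relations of the path in the
    Jacobian; the far end maps to \<open>z\<close> because \<open>r k = 1\<close>.\<close>
  define psi' where "psi' v = (if v \<le> N then psi v else z [^] r (v - N))" for v
  have d: "int (d t) = b t - (if t > 1 then 1 else 0) - (if t < k then 1 else 0)" if "0 < t" "t \<le> k" for t
    using P.b_ge_2[OF that] by (auto simp: d_def)
  have H: "psi v \<in> carrier \<Gamma>" "B z (psi v) = rat_mod_int 0" if "v \<le> N" for v
    using R.psi_closed[OF that] z symmetric by (auto simp: orthogonal_def zero_rat_mod_int_def)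
  \<comment> \<open>An old vertex other than 0 has no new neighbours, and \<open>h' v\<close>
    vanishes on the old vertices when \<open>v\<close> is new.\<close>
  have sum_old: "(\<Sum>w\<le>N + k. int (c' u w) * (h' v u - h' v w)) = (if u = v then M * int n else 0)"
    if v: "v \<le> N + k" and u: "0 < u" "u \<le> N" for u v
  proof -
    have "(\<Sum>w\<le>N + k. int (c' u w) * (h' v u - h' v w)) = (\<Sum>w\<le>N. int (c' u w) * (h' v u - h' v w))"
      using u by (intro sum.mono_neutral_right) (auto simp: c'_def)
    also have "\<dots> = (if v \<le> N then int n * (\<Sum>w\<le>N. int (c u w) * (h v u - h v w)) else 0)"
      using u by (auto simp: c'_def h'_def sum_distrib_left algebra_simps intro!: sum.cong sum.neutral)
    also have "\<dots> = (if u = v then M * int n else 0)"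
      using u R.green_laplacian[of v u] by auto
    finally show ?thesis .
  qed
  have sum_new: "(\<Sum>w\<le>N + k. int (c' u w) * (h' v u - h' v w)) = (if u = v then M * int n else 0)"
    if v: "v \<le> N + k" and u: "N < u" "u \<le> N + k" for u v
  proof -
    define t where "t = u - N"
    have t: "0 < t" "t \<le> k" "u = N + t" using u by (auto simp: t_def)
    define X where "X w = h' v u - h' v w" for w
    \<comment> \<open>The neighbours of \<open>u\<close> are 0 and its path neighbours. The guards
      remove \<open>u - 1 = N\<close> when \<open>t = 1\<close> and \<open>u + 1\<close>, which is
      out of range, when \<open>t = k\<close>.\<close>
    have "(\<Sum>w\<le>N + k. int (c' u w) * X w) = (\<Sum>w\<le>N + k. (if w = 0 then int (d t) * X 0 else 0)
        + (if w = u - 1 then (if t > 1 then X (u - 1) else 0) else 0)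
        + (if w = u + 1 then (if t < k then X (u + 1) else 0) else 0))"
      using t by (intro sum.cong) (auto simp: c'_def)
    also have "\<dots> = int (d t) * X 0 + (if t > 1 then X (u - 1) else 0) + (if t < k then X (u + 1) else 0)"
      using t by (auto simp: sum.distrib)
    also have "\<dots> = (if u = v then M * int n else 0)"
    proof (cases "v \<le> N")
      case True
      then have "X 0 = 0" "t > 1 \<Longrightarrow> X (u - 1) = 0" "X (u + 1) = 0"
        using t by (auto simp: X_def h'_def R.green_root)
      then show ?thesis using True t by auto
    next
      case False
      define i where "i = v - N"
      have i: "0 < i" "i \<le> k" "v = N + i" using False v by (auto simp: i_def)
      have "X 0 = M * P.green i t" using t i by (simp add: X_def h'_def)
      \<comment> \<open>At the path ends the absent neighbours are replaced by the boundary zeros of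
        \<open>green\<close>, so the guards combine with \<open>d t\<close> to give
        \<open>b t\<close>.\<close>
      moreover have "(if t > 1 then X (u - 1) else 0) = (if t > 1 then M * P.green i t else 0) - M * P.green i (t - 1)"
        using t i by (cases "t = 1") (auto simp: X_def h'_def P.green_0)
      moreover have "(if t < k then X (u + 1) else 0) = (if t < k then M * P.green i t else 0) - M * P.green i (Suc t)"
        using t i by (cases "t = k") (auto simp: X_def h'_def P.green_end)
      ultimately have "int (d t) * X 0 + (if t > 1 then X (u - 1) else 0) + (if t < k then X (u + 1) else 0) =
          M * (b t * P.green i t - P.green i (t - 1) - P.green i (Suc t))"
        by (simp add: d t algebra_simps)
      then show ?thesis using P.green_laplacian[OF i(1,2) t(1,2)] i t by auto
    qed
    finally show ?thesis unfolding X_def .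
  qed
  let ?E = "{(x, y). x \<noteq> y \<and> x \<le> N + k \<and> y \<le> N + k \<and> c' x y > 0}"
  have reach_old: "(0, v) \<in> ?E\<^sup>*" if "v \<le> N" for v
  proof -
    have "{(x, y). x \<noteq> y \<and> x \<le> N \<and> y \<le> N \<and> c x y > 0} \<subseteq> ?E" by (auto simp: c'_def)
    then show ?thesis using R.reachable[OF that] rtrancl_mono by blast
  qed
  have reach_new: "Suc t \<le> k \<Longrightarrow> (0, N + Suc t) \<in> ?E\<^sup>*" for t
  proof (induction t)
    case 0
    \<comment> \<open>The first path vertex has at most one path neighbour while
      \<open>b 1 \<ge> 2\<close>, so it is joined to 0; the others are reached along the
      path.\<close>
    have "d 1 > 0" using d[of 1] P.b_ge_2[of 1] P.k_pos by (auto split: if_splits)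
    then have "(0, N + Suc 0) \<in> ?E" using 0 by (simp add: c'_def)
    then show ?case by blast
  next
    case (Suc t)
    then have "(N + Suc t, N + Suc (Suc t)) \<in> ?E" by (simp add: c'_def)
    then show ?case using Suc by (meson Suc_leD rtrancl.rtrancl_into_rtrancl)
  qed
  \<comment> \<open>By bilinearity the value is \<open>a * r i * r j / n\<close>. As
    \<open>s k = a\<close>, \<open>s_cong_r\<close> replaces \<open>a * r i\<close> by
    \<open>s i\<close>, and for \<open>i \<le> j\<close> the product \<open>s i * r j\<close> is
    \<open>green i j\<close>.\<close>
  have zz: "B (z [^] r i) (z [^] r j) = rat_mod_int (of_int (P.green i j) / of_nat n)"
    if ij: "i \<le> k" "j \<le> k" "i \<le> j" for i j
  proof -
    obtain e where e: "a * r i - s i = int n * e" using P.s_cong_r[OF ij(1)] sk by blast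
    have "B (z [^] r i) z = rat_mod_int (of_int (r i) * (of_int a / of_nat n))"
      by (rule pairing_int_pow[OF z z pairing_z])
    then have "B (z [^] r j) (z [^] r i) = rat_mod_int (of_int (r j) * (of_int (r i) * (of_int a / of_nat n)))"
      using z symmetric[of "z [^] r i" z] by (intro pairing_int_pow) auto
    moreover have "of_int (r j) * (of_int (r i) * (of_int a / of_nat n)) - of_int (P.green i j) / of_nat n
        = (of_int (r j * (a * r i - s i)) / of_nat n :: rat)"
      using ij n_gt_1 by (simp add: P.green_def field_simps)
    then have "of_int (r j) * (of_int (r i) * (of_int a / of_nat n)) - of_int (P.green i j) / of_nat n
        = (of_int (r j * e) :: rat)"
      using n_gt_1 by (simp add: e)
    then have "rat_mod_int (of_int (r j) * (of_int (r i) * (of_int a / of_nat n))) =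
        rat_mod_int (of_int (P.green i j) / of_nat n)"
      by (simp only: rat_mod_int_eq_iff Ints_of_int)
    ultimately show ?thesis using symmetric[of "z [^] r i" "z [^] r j"] z by simp
  qed
  have "pairing_realization \<Gamma> B (N + k) c' (M * int n) h' psi'"
  proof unfold_locales
    show "c' i j = c' j i" for i j
      using R.weight_commute by (auto simp: c'_def)
    show "(0, v) \<in> ?E\<^sup>*" if "v \<le> N + k" for v
      using reach_old[of v] reach_new[of "v - N - 1"] that by (cases "v \<le> N") auto
    have "M * int n > 0" using R.M_pos n_gt_1 by (intro mult_pos_pos) auto
    then show "M * int n \<ge> 1" by linarith
    show "h' 0 v = 0" "h' v 0 = 0" for v by (auto simp: h'_def R.green_root)
    show "(\<Sum>w\<le>N + k. int (c' u w) * (h' v u - h' v w)) = (if u = v then M * int n else 0)"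
      if "v \<le> N + k" "0 < u" "u \<le> N + k" for u v
      using sum_old[OF that(1,2)] sum_new[OF that(1) _ that(3)] by (cases "u \<le> N") auto
    show closed: "psi' v \<in> carrier \<Gamma>" if "v \<le> N + k" for v
      using H(1) z by (simp add: psi'_def)
    show "psi' 0 = \<one>" using R.psi_root by (simp add: psi'_def)
    show "B (psi' v) (psi' w) = rat_mod_int (of_int (h' v w) / of_int (M * int n))"
      if v: "v \<le> N + k" and w: "w \<le> N + k" for v w
    proof -
      have mixed: "B (z [^] i) (psi x) = rat_mod_int 0" if "x \<le> N" for x and i :: int
        using pairing_int_pow[OF z H[OF that], of i] by simp
      consider "v \<le> N" "w \<le> N" | "v > N" "w \<le> N" | "v \<le> N" "w > N" | "v > N" "w > N" by linarith
      then show ?thesis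
      proof cases
        case 1
        then show ?thesis using R.pairing_psi[of v w] n_gt_1 by (simp add: psi'_def h'_def)
      next
        case 2
        then show ?thesis by (simp add: psi'_def h'_def mixed)
      next
        case 3
        then show ?thesis using symmetric[OF H(1)[OF 3(1)], of "z [^] r (w - N)"] z
          by (simp add: psi'_def h'_def mixed)
      next
        case 4
        have "B (z [^] r (v - N)) (z [^] r (w - N)) = rat_mod_int (of_int (P.green (v - N) (w - N)) / of_nat n)"
        proof (cases "v \<le> w")
          case True
          then show ?thesis using v w by (intro zz) auto
        next
          case False
          then have "B (z [^] r (w - N)) (z [^] r (v - N)) = rat_mod_int (of_int (P.green (w - N) (v - N)) / of_nat n)"
            using v w by (intro zz) auto
          then show ?thesis
            using z symmetric[of "z [^] r (v - N)" "z [^] r (w - N)"] by (simp add: P.green_commute)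
        qed
        then show ?thesis using 4 R.M_pos by (simp add: psi'_def h'_def)
      qed
    qed
    have sub: "psi' ` {..N + k} \<subseteq> carrier \<Gamma>" using closed by auto
    then interpret K: subgroup "generate \<Gamma> (psi' ` {..N + k})" \<Gamma> by (rule generate_is_subgroup)
    have "psi' (N + k) = z" using P.k_pos P.r_end z by (simp add: psi'_def int_pow_1)
    then have "z \<in> generate \<Gamma> (psi' ` {..N + k})" by (metis atMost_iff generate.incl imageI le_refl)
    then have zK: "z [^] i \<in> generate \<Gamma> (psi' ` {..N + k})" for i :: int
      using subgroup_int_pow_closed[OF K.subgroup_axioms] by blast
    \<comment> \<open>Generation inside \<open>H\<close> agrees with generation in \<Gamma>.
      Together with the powers of \<open>z\<close>, \<open>decompose\<close> then yields the whole
      group.\<close>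
    have "psi ` {..N} \<subseteq> H" using R.psi_closed by auto
    then have "H = generate \<Gamma> (psi ` {..N})"
      using R.generating generate_consistent[OF _ orthogonal_subgroup[OF z]] by simp
    also have "\<dots> \<subseteq> generate \<Gamma> (psi' ` {..N + k})"
      by (rule mono_generate) (force simp: psi'_def)
    finally have HK: "H \<subseteq> generate \<Gamma> (psi' ` {..N + k})" .
    show "generate \<Gamma> (psi' ` {..N + k}) = carrier \<Gamma>"
    proof
      show "carrier \<Gamma> \<subseteq> generate \<Gamma> (psi' ` {..N + k})"
      proof
        fix w assume "w \<in> carrier \<Gamma>"
        then obtain i u where "u \<in> H" "w = z [^] (i :: int) \<otimes> u" by (rule decompose)
        then show "w \<in> generate \<Gamma> (psi' ` {..N + k})" using zK HK by (auto intro: generate.eng)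
      qed
    qed (rule K.subset)
  qed
  then show ?thesis by blast
qed

end

section \<open>Realizations by induction on the order of the group\<close>

lemma (in group_with_pairing) trivial_realization:
  assumes "carrier \<Gamma> = {\<one>}"
  shows "pairing_realization \<Gamma> B 0 (\<lambda>_ _. 0) 1 (\<lambda>_ _. 0) (\<lambda>_. \<one>)"
proof -
  have "generate \<Gamma> {\<one>} = carrier \<Gamma>"
    using generate_incl[of "{\<one>}"] generate.one[of \<Gamma>] assms by auto
  moreover have "B \<one> \<one> = rat_mod_int 0"
    by (simp add: pairing_one zero_rat_mod_int_def)
  ultimately show ?thesis
    by (intro pairing_realization.intro pairing_realization_axioms.intro group_with_pairing_axioms) auto
qed

text \<open>Strong induction starting from the one-vertex graph. The orthogonal complement of
  \<open>z\<close> omits \<open>z\<close>, so it is smaller, and by Lagrange its order is again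
  odd.\<close>

lemma realization_exists:
  assumes "group_with_pairing \<Gamma> B" "odd (order \<Gamma>)"
  shows "\<exists>N c M h psi. pairing_realization \<Gamma> B N c M h psi"
  using assms
proof (induction "order \<Gamma>" arbitrary: \<Gamma> rule: less_induct)
  case less
  interpret group_with_pairing \<Gamma> B by (rule less.prems(1))
  show ?case
  proof (cases "carrier \<Gamma> = {\<one>\<^bsub>\<Gamma>\<^esub>}")
    case True
    then show ?thesis using trivial_realization by blast
  next
    case False
    obtain z n a where za: "z \<in> carrier \<Gamma>" "n > 1" "z [^]\<^bsub>\<Gamma>\<^esub> n = \<one>\<^bsub>\<Gamma>\<^esub>" "0 < a" "a < int n"
      "coprime a (int n)" "B z z = rat_mod_int (of_int a / of_nat n)"
      by (rule anisotropic_element[OF less.prems(2) False])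
    interpret A: anisotropic_cyclic \<Gamma> B z n a
      by (intro anisotropic_cyclic.intro anisotropic_cyclic_axioms.intro group_with_pairing_axioms za)
    have "odd (order (\<Gamma>\<lparr>carrier := A.H\<rparr>))"
      using A.order_orthogonal_dvd less.prems(2) dvd_trans by blast
    from less.hyps[OF A.order_orthogonal_less A.group_with_pairing_orthogonal this]
    show ?thesis using A.extend_realization by blast
  qed
qed

theorem theorem2:
  fixes \<Gamma> :: "('a, 'b) monoid_scheme"
    and B :: "'a \<Rightarrow> 'a \<Rightarrow> rat_mod_int"
  assumes "generalized_riemann_hypothesis"
    and "group_with_pairing \<Gamma> B"
    and "odd (order \<Gamma>)"
  shows "\<exists>G :: nat multigraph. connected_multigraph G \<and>
           isomorphic_with_pairing \<Gamma> B (Jac G) (monodromy_pairing G)"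
proof -
  obtain N c M h psi where "pairing_realization \<Gamma> B N c M h psi"
    using realization_exists[OF assms(2,3)] by blast
  then interpret pairing_realization \<Gamma> B N c M h psi .
  show ?thesis using isomorphic_Jac G.connected_multigraph_axioms by blast
qed

end
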